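(* Suppose non-coherent downlink transmission with MR precoding based on the phase-aware MMSE estimator is used, i.e. $w_{m,k}=\hat h^{\mathrm{mmse}}_{m,k}/\sqrt{\mathbb E\{|\hat h^{\mathrm{mmse}}_{m,k}|^2\}}$ for all $m,k$. Then for all APs $n$ and UEs $k,l$: $$\mathbb E\{h_{n,k}^*w_{n,k}\}=\sqrt{\hat p_k\tau_p\beta_{n,k}^2\lambda_{n,k}^{-1}+\bar h_{n,k}^2},\qquad \mathbb E\{|\hat h^{\mathrm{mmse}}_{n,l}|^2\}=\hat p_l\tau_p\beta_{n,l}^2\lambda_{n,l}^{-1}+\bar h_{n,l}^2,$$ $$\mathbb E\{|h_{n,k}^*w_{n,l}|^2\}=\beta'_{n,k}+\begin{cases}\dfrac{\hat p_k\hat p_l\tau_p^2\beta_{n,k}^2\beta_{n,l}^2\lambda_{n,l}^{-2}}{\hat p_l\tau_p\beta_{n,l}^2\lambda_{n,l}^{-1}+\bar h_{n,l}^2},& l\in\mathcal P_k\setminus\{k\},\\[3mm]\dfrac{\hat p_k^2\tau_p^2\beta_{n,k}^4\lambda_{n,k}^{-2}+2\hat p_k\tau_p\beta_{n,k}^2\lambda_{n,k}^{-1}\bar h_{n,k}^2}{\hat p_k\tau_p\beta_{n,k}^2\lambda_{n,k}^{-1}+\bar h_{n,k}^2},& l=k,\\[3mm]0,& l\notin\mathcal P_k.\end{cases}$$ Consequently the non-coherent downlink effective SINR of UE $k$ equals $$\gamma^{\mathrm{dl,mmse}}_k=\frac{\mathrm{tr}(\mathbf D_k\mathbf Z_k)}{\sum_{l=1}^K\mathrm{tr}(\mathbf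 D_l\mathbf R'_k)+\sum_{l\in\mathcal P_k\setminus\{k\}}\hat p_k\hat p_l\tau_p^2\,\mathrm{tr}\big(\mathbf D_l(\mathbf R_k\boldsymbol\Lambda_l\mathbf R_l)^2\mathbf Z_l^{-1}\big)-\mathrm{tr}(\mathbf D_k\mathbf L_k^2\mathbf Z_k^{-1})+\sigma^2_{\mathrm{dl}}},$$ where $\mathbf D_k=\mathrm{diag}(\rho_{1,k},\dots,\rho_{M,k})$ and $\mathbf Z_k=\hat p_k\tau_p\boldsymbol\Omega_k+\mathbf L_k$.
   Context: Channels. There are $M$ single-antenna access points (APs) and $K$ single-antenna users (UEs). The channel between AP $m$ and UE $k$ is $h_{m,k}=\bar h_{m,k}e^{j\varphi_{m,k}}+g_{m,k}$, with $\bar h_{m,k}\ge 0$ deterministic, $\varphi_{m,k}$ uniform on $[-\pi,\pi]$, $g_{m,k}\sim\mathcal N_{\mathbb C}(0,\beta_{m,k})$ (circularly symmetric complex Gaussian), $\beta_{m,k}>0$; all $\varphi_{m,k},g_{m,k}$ are mutually independent over $m,k$. Pilots. $\tau_p<K$ is the pilot length. Each UE uses one of $\tau_p$ mutually orthogonal pilot sequences $\boldsymbol\phi_k\in\mathbb C^{\tau_p}$ with $\|\boldsymbol\phi_k\|^2=\tau_p$, with pilot power $\hat p_k>0$. $\mathcal P_k$ is the set of UEs using the same pilot as UE $k$ (including $k$). After correlation with the pilot, AP $m$ has $$y^p_{m,k}=\sum_{l\in\mathcal P_k}\sqrt{\hat p_l}\,\tau_p h_{m,l}+\boldsymbol\phi_k^H\mathbf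 n^p_m,$$ where the $\mathbf n^p_m\sim\mathcal N_{\mathbb C}(\mathbf 0,\sigma^2_{\mathrm{ul}}\mathbf I_{\tau_p})$ are independent over $m$ and independent of all channels, and $\sigma^2_{\mathrm{ul}}>0$. Phase-aware MMSE estimator: $$\hat h^{\mathrm{mmse}}_{m,k}=\bar h_{m,k}e^{j\varphi_{m,k}}+\frac{\sqrt{\hat p_k}\,\beta_{m,k}(y^p_{m,k}-\bar y^p_{m,k})}{\lambda_{m,k}},$$ with $\bar y^p_{m,k}=\sum_{l\in\mathcal P_k}\sqrt{\hat p_l}\tau_p\bar h_{m,l}e^{j\varphi_{m,l}}$ and $\lambda_{m,k}=\sum_{l\in\mathcal P_k}\hat p_l\tau_p\beta_{m,l}+\sigma^2_{\mathrm{ul}}$. Also $\beta'_{m,k}=\beta_{m,k}+\bar h_{m,k}^2$. Matrices (all $M\times M$ diagonal): $\mathbf R_k=\mathrm{diag}(\beta_{1,k},\dots,\beta_{M,k})$, $\mathbf L_k=\mathrm{diag}(\bar h_{1,k}^2,\dots,\bar h_{M,k}^2)$, $\mathbf R'_k=\mathbf R_k+\mathbf L_k$, $\boldsymbol\Lambda_k=\mathrm{diag}(\lambda_{1,k},\dots,\lambda_{M,k})^{-1}$, $\boldsymbol\Omega_k=\mathbf R_k\boldsymbol\Lambda_k\mathbf R_k$. Non-coherent downlink. AP $m$ sends $\sum_k w_{m,k}\varsigma_{m,k}$, where the data symbols $\varsigma_{m,k}\sim\mathcal N_{\mathbb C}(0,\rho_{m,k})$ are independent over $m,k$, $\rho_{m,k}\ge0$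 deterministic with $\sum_l\rho_{m,l}\le\rho^{\mathrm{dl}}$; the receiver noise variance is $\sigma^2_{\mathrm{dl}}>0$. The non-coherent downlink effective SINR of UE $k$ (giving SE $\frac{\tau_d}{\tau_c}\log_2(1+\gamma)$ under successive interference cancellation) is defined as $$\gamma^{\mathrm{dl,nc}}_k=\frac{\sum_{n=1}^M\rho_{n,k}|\mathbb E\{h_{n,k}^*w_{n,k}\}|^2}{\sum_{n=1}^M\sum_{l=1}^K\rho_{n,l}\mathbb E\{|h_{n,k}^*w_{n,l}|^2\}-\sum_{n=1}^M\rho_{n,k}|\mathbb E\{h_{n,k}^*w_{n,k}\}|^2+\sigma^2_{\mathrm{dl}}}.$$ *)

theory Defs
  imports "HOL-Probability.Probability"
begin

section \<open>Probability laws\<close>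

definition has_law :: "'w measure \<Rightarrow> ('w \<Rightarrow> 'b::topological_space) \<Rightarrow> 'b measure \<Rightarrow> bool" where
  "has_law P X \<mu> \<longleftrightarrow> X \<in> borel_measurable P \<and> distr P borel X = \<mu>"

definition std_normal :: "real measure" where
  "std_normal = density lborel std_normal_density"

text \<open>
  The circularly symmetric law with variance \<open>v\<close>: real and imaginary parts are independent
  real Gaussians, each of variance \<open>v / 2\<close>. The case \<open>v = 0\<close> is the point mass at \<open>0\<close>.
\<close>
definition complex_normal :: "real \<Rightarrow> complex measure" where
  "complex_normal v =
     distr (std_normal \<Otimes>\<^sub>M std_normal) borel
       (\<lambda>(x, y). Complex (sqrt (v / 2) * x) (sqrt (v / 2) * y))"

text \<open>The law on complex vectors with mean zero and covariance \<open>v\<close> times the identity.\<close>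
definition complex_normal_vec :: "real \<Rightarrow> (complex ^ 'n::finite) measure" where
  "complex_normal_vec v =
     distr (\<Pi>\<^sub>M i\<in>(UNIV :: 'n set). complex_normal v) borel (\<lambda>x. \<chi> i. x i)"

section \<open>Linear algebra\<close>

definition herm_prod :: "complex ^ 'n::finite \<Rightarrow> complex ^ 'n \<Rightarrow> complex" where
  "herm_prod u v = (\<Sum>i\<in>UNIV. cnj (u $ i) * v $ i)"

definition diag :: "('n::finite \<Rightarrow> real) \<Rightarrow> real ^ 'n ^ 'n" where
  "diag d = (\<chi> i j. if i = j then d i else 0)"

section \<open>System model\<close>

text \<open>
  The access points are indexed by \<open>'ap\<close>, the users by \<open>'ue\<close>, and the pilot sequences by \<open>'pl\<close>.
  There are as many mutually orthogonal pilots as their length, so \<open>'pl\<close> also indexes the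
  entries of a pilot and the pilot length is \<open>CARD('pl)\<close>.
\<close>
record ('w, 'ap, 'ue, 'pl) cf_system =
  prob_sp :: "'w measure"
  los :: "'ap \<Rightarrow> 'ue \<Rightarrow> real"  \<comment> \<open>line-of-sight amplitude, \<open>h\<close>-bar\<close>
  beta :: "'ap \<Rightarrow> 'ue \<Rightarrow> real"
  phase :: "'ap \<Rightarrow> 'ue \<Rightarrow> 'w \<Rightarrow> real"  \<comment> \<open>\<open>\<phi>\<close> of the channel\<close>
  scatter :: "'ap \<Rightarrow> 'ue \<Rightarrow> 'w \<Rightarrow> complex"  \<comment> \<open>\<open>g\<close>\<close>
  pilot_book :: "'pl \<Rightarrow> complex ^ 'pl"
  pilot_of :: "'ue \<Rightarrow> 'pl"
  pilot_power :: "'ue \<Rightarrow> real"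
  pilot_noise :: "'ap \<Rightarrow> 'w \<Rightarrow> complex ^ 'pl"
  var_ul :: real
  symbol :: "'ap \<Rightarrow> 'ue \<Rightarrow> 'w \<Rightarrow> complex"  \<comment> \<open>downlink data symbols\<close>
  dl_power :: "'ap \<Rightarrow> 'ue \<Rightarrow> real"  \<comment> \<open>\<open>\<rho>\<close>, the variances of the symbols\<close>
  dl_budget :: real
  var_dl :: real

text \<open>
  The sources of randomness in the channel estimation phase have different value types, so their
  mutual independence is stated through the generated sigma-algebras.
\<close>
datatype ('ap, 'ue) source = Phase 'ap 'ue | Scatter 'ap 'ue | Pilot_Noise 'ap

primrec source_events ::
  "('w, 'ap, 'ue, 'pl::finite) cf_system \<Rightarrow> ('ap, 'ue) source \<Rightarrow> 'w set set" where
  "source_events S (Phase m k) = sets (vimage_algebra (space (prob_sp S)) (phase S m k) borel)"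
| "source_events S (Scatter m k) = sets (vimage_algebra (space (prob_sp S)) (scatter S m k) borel)"
| "source_events S (Pilot_Noise m) =
     sets (vimage_algebra (space (prob_sp S)) (pilot_noise S m) borel)"

locale cf_model =
  fixes S :: "('w, 'ap::finite, 'ue::finite, 'pl::finite) cf_system"
  assumes prob_space: "prob_space (prob_sp S)"
    and los_nonneg: "los S m k \<ge> 0"
    and beta_pos: "beta S m k > 0"
    and phase_law: "has_law (prob_sp S) (phase S m k) (uniform_measure lborel {-pi..pi})"
    and scatter_law: "has_law (prob_sp S) (scatter S m k) (complex_normal (beta S m k))"
    and pilot_length: "CARD('pl) < CARD('ue)"
    and pilot_norm: "(norm (pilot_book S i))\<^sup>2 = real CARD('pl)"
    and pilot_orthogonal: "i \<noteq> j \<Longrightarrow> herm_prod (pilot_book S i) (pilot_book S j) = 0"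
    and pilot_power_pos: "pilot_power S k > 0"
    and var_ul_pos: "var_ul S > 0"
    and pilot_noise_law: "has_law (prob_sp S) (pilot_noise S m) (complex_normal_vec (var_ul S))"
    and sources_independent: "prob_space.indep_sets (prob_sp S) (source_events S) UNIV"
    and dl_power_nonneg: "dl_power S m k \<ge> 0"
    and dl_power_budget: "(\<Sum>l\<in>UNIV. dl_power S m l) \<le> dl_budget S"
    and symbol_law: "has_law (prob_sp S) (symbol S m k) (complex_normal (dl_power S m k))"
    and symbols_independent:
      "prob_space.indep_vars (prob_sp S) (\<lambda>_. borel) (\<lambda>(m, k). symbol S m k) UNIV"
    and var_dl_pos: "var_dl S > 0"

section \<open>Channels and channel estimates\<close>

definition channel ::
  "('w, 'ap::finite, 'ue::finite, 'pl::finite) cf_system \<Rightarrow> 'ap \<Rightarrow> 'ue \<Rightarrow> 'w \<Rightarrow> complex" where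
  "channel S m k \<omega> = of_real (los S m k) * cis (phase S m k \<omega>) + scatter S m k \<omega>"

definition copilot :: "('w, 'ap::finite, 'ue::finite, 'pl::finite) cf_system \<Rightarrow> 'ue \<Rightarrow> 'ue set" where
  "copilot S k = {l. pilot_of S l = pilot_of S k}"

definition pilot_len :: "('w, 'ap::finite, 'ue::finite, 'pl::finite) cf_system \<Rightarrow> real" where
  "pilot_len S = real CARD('pl)"

definition pilot_obs ::
  "('w, 'ap::finite, 'ue::finite, 'pl::finite) cf_system \<Rightarrow> 'ap \<Rightarrow> 'ue \<Rightarrow> 'w \<Rightarrow> complex" where
  "pilot_obs S m k \<omega> =
     (\<Sum>l\<in>copilot S k. of_real (sqrt (pilot_power S l) * pilot_len S) * channel S m l \<omega>)
     + herm_prod (pilot_book S (pilot_of S k)) (pilot_noise S m \<omega>)"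

definition pilot_obs_mean ::
  "('w, 'ap::finite, 'ue::finite, 'pl::finite) cf_system \<Rightarrow> 'ap \<Rightarrow> 'ue \<Rightarrow> 'w \<Rightarrow> complex" where
  "pilot_obs_mean S m k \<omega> =
     (\<Sum>l\<in>copilot S k.
        of_real (sqrt (pilot_power S l) * pilot_len S * los S m l) * cis (phase S m l \<omega>))"

definition lam ::
  "('w, 'ap::finite, 'ue::finite, 'pl::finite) cf_system \<Rightarrow> 'ap \<Rightarrow> 'ue \<Rightarrow> real" where
  "lam S m k = (\<Sum>l\<in>copilot S k. pilot_power S l * pilot_len S * beta S m l) + var_ul S"

definition h_mmse ::
  "('w, 'ap::finite, 'ue::finite, 'pl::finite) cf_system \<Rightarrow> 'ap \<Rightarrow> 'ue \<Rightarrow> 'w \<Rightarrow> complex" where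
  "h_mmse S m k \<omega> =
     of_real (los S m k) * cis (phase S m k \<omega>)
     + of_real (sqrt (pilot_power S k) * beta S m k)
       * (pilot_obs S m k \<omega> - pilot_obs_mean S m k \<omega>) / of_real (lam S m k)"

definition beta' ::
  "('w, 'ap::finite, 'ue::finite, 'pl::finite) cf_system \<Rightarrow> 'ap \<Rightarrow> 'ue \<Rightarrow> real" where
  "beta' S m k = beta S m k + (los S m k)\<^sup>2"

section \<open>Matrices\<close>

definition R_mat ::
  "('w, 'ap::finite, 'ue::finite, 'pl::finite) cf_system \<Rightarrow> 'ue \<Rightarrow> real ^ 'ap ^ 'ap" where
  "R_mat S k = diag (\<lambda>m. beta S m k)"

definition L_mat ::
  "('w, 'ap::finite, 'ue::finite, 'pl::finite) cf_system \<Rightarrow> 'ue \<Rightarrow> real ^ 'ap ^ 'ap" where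
  "L_mat S k = diag (\<lambda>m. (los S m k)\<^sup>2)"

definition R'_mat ::
  "('w, 'ap::finite, 'ue::finite, 'pl::finite) cf_system \<Rightarrow> 'ue \<Rightarrow> real ^ 'ap ^ 'ap" where
  "R'_mat S k = R_mat S k + L_mat S k"

definition Lam_mat ::
  "('w, 'ap::finite, 'ue::finite, 'pl::finite) cf_system \<Rightarrow> 'ue \<Rightarrow> real ^ 'ap ^ 'ap" where
  "Lam_mat S k = matrix_inv (diag (\<lambda>m. lam S m k))"

definition Omega_mat ::
  "('w, 'ap::finite, 'ue::finite, 'pl::finite) cf_system \<Rightarrow> 'ue \<Rightarrow> real ^ 'ap ^ 'ap" where
  "Omega_mat S k = R_mat S k ** Lam_mat S k ** R_mat S k"

definition D_mat ::
  "('w, 'ap::finite, 'ue::finite, 'pl::finite) cf_system \<Rightarrow> 'ue \<Rightarrow> real ^ 'ap ^ 'ap" where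
  "D_mat S k = diag (\<lambda>m. dl_power S m k)"

definition Z_mat ::
  "('w, 'ap::finite, 'ue::finite, 'pl::finite) cf_system \<Rightarrow> 'ue \<Rightarrow> real ^ 'ap ^ 'ap" where
  "Z_mat S k = (pilot_power S k * pilot_len S) *\<^sub>R Omega_mat S k + L_mat S k"

section \<open>Non-coherent downlink\<close>

definition expect :: "('w, 'ap, 'ue, 'pl::finite) cf_system \<Rightarrow>
    ('w \<Rightarrow> 'b::{banach, second_countable_topology}) \<Rightarrow> 'b" where
  "expect S f = (\<integral>\<omega>. f \<omega> \<partial>prob_sp S)"

text \<open>The effective SINR for an arbitrary choice \<open>w\<close> of (random) precoders.\<close>
definition sinr_dl_nc :: "('w, 'ap::finite, 'ue::finite, 'pl::finite) cf_system \<Rightarrow>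
    ('ap \<Rightarrow> 'ue \<Rightarrow> 'w \<Rightarrow> complex) \<Rightarrow> 'ue \<Rightarrow> real" where
  "sinr_dl_nc S w k =
     (\<Sum>n\<in>UNIV. dl_power S n k * (cmod (expect S (\<lambda>\<omega>. cnj (channel S n k \<omega>) * w n k \<omega>)))\<^sup>2)
     / ((\<Sum>n\<in>UNIV. \<Sum>l\<in>UNIV.
           dl_power S n l * expect S (\<lambda>\<omega>. (cmod (cnj (channel S n k \<omega>) * w n l \<omega>))\<^sup>2))
        - (\<Sum>n\<in>UNIV. dl_power S n k
             * (cmod (expect S (\<lambda>\<omega>. cnj (channel S n k \<omega>) * w n k \<omega>)))\<^sup>2)
        + var_dl S)"

definition mr_mmse :: "('w, 'ap::finite, 'ue::finite, 'pl::finite) cf_system \<Rightarrow>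
    'ap \<Rightarrow> 'ue \<Rightarrow> 'w \<Rightarrow> complex" where
  "mr_mmse S m k \<omega> =
     h_mmse S m k \<omega> / of_real (sqrt (expect S (\<lambda>\<omega>'. (cmod (h_mmse S m k \<omega>'))\<^sup>2)))"

end

theory Submission
  imports Defs
begin

text \<open>
  For every \<open>k\<close> and \<open>l\<close>, pilot-sharing or not, the channel and the estimate have the form
  \<open>h = a + g\<close> and \<open>a' + d g + r\<close>, where \<open>a, a'\<close> are the line-of-sight terms of constant modulus,
  \<open>g\<close> is the scattered component of \<open>h\<close>, \<open>d\<close> is a real constant (zero unless \<open>k\<close> and \<open>l\<close> share a
  pilot), and \<open>r\<close> is centred; the three blocks \<open>(a, a')\<close>, \<open>g\<close>, \<open>r\<close> are independent. If \<open>v\<close> is the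
  variance of \<open>g\<close> and \<open>m = E[a* a']\<close>, the circular Gaussian moments \<open>E g\<^sup>2 = 0\<close>, \<open>E |g|\<^sup>2 g = 0\<close> and
  \<open>E |g|^4 = 2 v\<^sup>2\<close> make the second moment of the product equal to the product of the second moments
  plus \<open>d\<^sup>2 v\<^sup>2 + 2 d v Re m\<close>, and the uniform phases give \<open>m = 0\<close> for \<open>k \<noteq> l\<close>.
\<close>

section \<open>Gaussian moments\<close>

lemma prob_space_std_normal: "prob_space std_normal"
  unfolding std_normal_def by (rule prob_space_normal_density) simp

lemma sets_std_normal [measurable_cong]: "sets std_normal = sets borel"
  by (simp add: std_normal_def)

lemma std_normal_moment:
  assumes "has_bochner_integral lborel (\<lambda>x. std_normal_density x * x ^ k) m"
  shows "has_bochner_integral std_normal (\<lambda>x. x ^ k) m"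
  unfolding std_normal_def
  by (rule has_bochner_integral_density) (use assms in auto)

text \<open>The moment of order 2k is (2k)! / (2^k k!), hence 1, 1 and 3, and odd moments vanish.
  The forms \<open>x ^ 0\<close> and \<open>x ^ 1\<close> are kept so that every monomial in two
  coordinates falls under the one product rule \<open>std_normal_pair_moment\<close>.\<close>

lemma std_normal_moments:
  "has_bochner_integral std_normal (\<lambda>x. x ^ 0) 1"
  "has_bochner_integral std_normal (\<lambda>x. x ^ 1) 0"
  "has_bochner_integral std_normal (\<lambda>x. x ^ 2) 1"
  "has_bochner_integral std_normal (\<lambda>x. x ^ 3) 0"
  "has_bochner_integral std_normal (\<lambda>x. x ^ 4) 3"
  using std_normal_moment_even[of 0] std_normal_moment_odd[of 0] std_normal_moment_even[of 1]
    std_normal_moment_odd[of 1] std_normal_moment_even[of 2]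
  by (intro std_normal_moment; simp add: fact_numeral numeral_3_eq_3)+

text \<open>Fubini: absolute integrability comes from the integrals of |f| and |g|, and the iterated
  integral then factors.\<close>

lemma has_bochner_integral_pair_mult:
  fixes f :: "'a \<Rightarrow> real" and g :: "'b \<Rightarrow> real"
  assumes "prob_space M" "prob_space N"
    and f: "has_bochner_integral M f a" and g: "has_bochner_integral N g b"
  shows "has_bochner_integral (M \<Otimes>\<^sub>M N) (\<lambda>z. f (fst z) * g (snd z)) (a * b)"
proof -
  interpret M: prob_space M by fact
  interpret N: prob_space N by fact
  interpret pair_sigma_finite M N ..
  have [measurable]: "f \<in> borel_measurable M" "g \<in> borel_measurable N"
    using f g by (auto simp: has_bochner_integral_iff)
  have fi: "integrable M f" "integrable N g" "integral\<^sup>L M f = a" "integral\<^sup>L N g = b"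
    using f g by (auto simp: has_bochner_integral_iff)
  have int: "integrable (M \<Otimes>\<^sub>M N) (\<lambda>z. f (fst z) * g (snd z))"
    by (rule Fubini_integrable) (use fi in \<open>auto simp: abs_mult\<close>)
  show ?thesis
    using integral_fst'[OF int] int fi by (simp add: has_bochner_integral_iff)
qed

lemma has_bochner_integral_complex_normal:
  fixes f :: "complex \<Rightarrow> 'b::{banach, second_countable_topology}"
  assumes [measurable]: "f \<in> borel_measurable borel"
    and f: "has_bochner_integral (std_normal \<Otimes>\<^sub>M std_normal)
      (\<lambda>z. f (Complex (sqrt (v / 2) * fst z) (sqrt (v / 2) * snd z))) c"
  shows "has_bochner_integral (complex_normal v) f c"
proof -
  have [measurable]: "(\<lambda>(x, y). Complex (sqrt (v / 2) * x) (sqrt (v / 2) * y))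
    \<in> std_normal \<Otimes>\<^sub>M std_normal \<rightarrow>\<^sub>M borel"
    unfolding Complex_eq by measurable
  show ?thesis
    using f unfolding has_bochner_integral_iff complex_normal_def
    by (simp add: integrable_distr_eq integral_distr case_prod_beta)
qed

lemma prob_space_complex_normal: "prob_space (complex_normal v)"
proof -
  interpret N: prob_space std_normal by (rule prob_space_std_normal)
  interpret NN: pair_prob_space std_normal std_normal ..
  show ?thesis
    unfolding complex_normal_def
    by (rule NN.prob_space_distr) (unfold Complex_eq, measurable)
qed

lemma sets_complex_normal [measurable_cong, simp]: "sets (complex_normal v) = sets borel"
  by (simp add: complex_normal_def)

lemma std_normal_pair_moment:
  assumes "has_bochner_integral std_normal (\<lambda>x. x ^ i) a"
    and "has_bochner_integral std_normal (\<lambda>x. x ^ j) b"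
  shows "has_bochner_integral (std_normal \<Otimes>\<^sub>M std_normal) (\<lambda>z. fst z ^ i * snd z ^ j) (a * b)"
  using has_bochner_integral_pair_mult[OF prob_space_std_normal prob_space_std_normal assms] .

text \<open>Each integrand expands into monomials of two independent standard normals, scaled by
  powers of s = sqrt (v / 2). Monomials with an odd exponent integrate to 0; in g^2 the
  contributions of the two squares cancel; for |g|^4 the total is v^2 (3/4 + 3/4 + 1/2). The
  assumption on \<open>v\<close> enters as \<open>s * s = v / 2\<close>.\<close>

lemma complex_normal_moments:
  assumes "v \<ge> 0"
  shows complex_normal_mean: "has_bochner_integral (complex_normal v) (\<lambda>g. g) 0"
    and complex_normal_square: "has_bochner_integral (complex_normal v) (\<lambda>g. g\<^sup>2) 0"
    and complex_normal_variance: "has_bochner_integral (complex_normal v) (\<lambda>g. (cmod g)\<^sup>2) v"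
    and complex_normal_third:
      "has_bochner_integral (complex_normal v) (\<lambda>g. of_real ((cmod g)\<^sup>2) * g) 0"
    and complex_normal_fourth:
      "has_bochner_integral (complex_normal v) (\<lambda>g. (cmod g) ^ 4) (2 * v\<^sup>2)"
proof -
  let ?NN = "std_normal \<Otimes>\<^sub>M std_normal"
  define s where "s = sqrt (v / 2)"
  have s: "s * s = v / 2" using assms by (simp add: s_def)
  note m = std_normal_moments
  note H = has_bochner_integral_complex_normal[where v = v, folded s_def]
  have c: "has_bochner_integral ?NN (\<lambda>z. complex_of_real (fst z ^ i * snd z ^ j)) (of_real (a * b))"
    if "has_bochner_integral std_normal (\<lambda>x. x ^ i) a"
      and "has_bochner_integral std_normal (\<lambda>x. x ^ j) b" for i j a b
    using has_bochner_integral_of_real[OF std_normal_pair_moment[OF that]] .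
  note p = std_normal_pair_moment
  note add = has_bochner_integral_add and mult = has_bochner_integral_mult_right
  show "has_bochner_integral (complex_normal v) (\<lambda>g. g) 0"
    \<comment> \<open>Here and below the factors given to \<open>mult\<close> are the coefficients
      of the expansion of the integrand.\<close>
    by (rule H) (use add[OF mult[OF c[OF m(2) m(1)], of "of_real s"]
        mult[OF c[OF m(1) m(2)], of "\<i> * of_real s"]]
        in \<open>simp_all add: Complex_eq algebra_simps\<close>)
  show "has_bochner_integral (complex_normal v) (\<lambda>g. g\<^sup>2) 0"
    by (rule H) (use add[OF mult[OF c[OF m(3) m(1)], of "of_real s * of_real s"]
        add[OF mult[OF c[OF m(1) m(3)], of "- (of_real s * of_real s)"]
          mult[OF c[OF m(2) m(2)], of "2 * \<i> * of_real s * of_real s"]]]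
        in \<open>simp_all add: Complex_eq algebra_simps power2_eq_square\<close>)
  show "has_bochner_integral (complex_normal v) (\<lambda>g. (cmod g)\<^sup>2) v"
    by (rule H) (use add[OF mult[OF p[OF m(3) m(1)], of "s * s"]
        mult[OF p[OF m(1) m(3)], of "s * s"]]
        in \<open>simp_all add: cmod_power2 power_mult_distrib power2_eq_square[of s] s\<close>)
  show "has_bochner_integral (complex_normal v) (\<lambda>g. of_real ((cmod g)\<^sup>2) * g) 0"
    by (rule H) (use add[OF add[OF mult[OF c[OF m(4) m(1)], of "of_real s * of_real s * of_real s"]
        mult[OF c[OF m(2) m(3)], of "of_real s * of_real s * of_real s"]]
        add[OF mult[OF c[OF m(1) m(4)], of "\<i> * of_real s * of_real s * of_real s"]
        mult[OF c[OF m(3) m(2)], of "\<i> * of_real s * of_real s * of_real s"]]]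
        in \<open>simp_all add: Complex_eq[symmetric] cmod_power2\<close>,
        simp_all add: Complex_eq power2_eq_square power3_eq_cube algebra_simps)
  have eq: "(cmod (Complex (s * x) (s * y))) ^ 4 = (v\<^sup>2 / 4) * (x ^ 4 * y ^ 0)
     + ((v\<^sup>2 / 4) * (x ^ 0 * y ^ 4) + (v\<^sup>2 / 2) * (x ^ 2 * y ^ 2))" for x y
  proof -
    have "(cmod (Complex (s * x) (s * y))) ^ 4 = ((cmod (Complex (s * x) (s * y)))\<^sup>2)\<^sup>2"
      by simp
    also have "\<dots> = (s * s)\<^sup>2 * (x\<^sup>2 + y\<^sup>2)\<^sup>2"
      by (simp only: cmod_power2 complex.sel) algebra
    finally show ?thesis unfolding s by (simp add: field_simps power2_sum)
  qed
  show "has_bochner_integral (complex_normal v) (\<lambda>g. (cmod g) ^ 4) (2 * v\<^sup>2)"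
    by (rule H) (use add[OF mult[OF p[OF m(5) m(1)], of "v\<^sup>2 / 4"]
        add[OF mult[OF p[OF m(1) m(5)], of "v\<^sup>2 / 4"] mult[OF p[OF m(3) m(3)], of "v\<^sup>2 / 2"]]]
        in \<open>simp_all add: eq\<close>)
qed

section \<open>Independence\<close>

lemma has_bochner_integral_Re:
  "has_bochner_integral M f x \<Longrightarrow> has_bochner_integral M (\<lambda>\<omega>. Re (f \<omega>)) (Re x)"
  by (rule has_bochner_integral_bounded_linear[OF bounded_linear_Re])

lemma has_bochner_integral_cnj:
  "has_bochner_integral M f x \<Longrightarrow> has_bochner_integral M (\<lambda>\<omega>. cnj (f \<omega>)) (cnj x)"
  by (rule has_bochner_integral_bounded_linear[OF bounded_linear_cnj])

lemma borel_measurable_cnj [measurable]: "cnj \<in> borel_measurable borel"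
  by (intro borel_measurable_continuous_onI continuous_intros)

lemma borel_measurable_fst_snd [measurable, simp]:
  "fst \<in> (borel :: ('b::topological_space \<times> 'c::topological_space) measure) \<rightarrow>\<^sub>M borel"
  "snd \<in> (borel :: ('b \<times> 'c) measure) \<rightarrow>\<^sub>M borel"
  by (intro borel_measurable_continuous_onI continuous_intros)+

text \<open>The product is dominated by the sum of the two squared moduli.\<close>

lemma integrable_square_cmod_mult:
  fixes f g :: "'a \<Rightarrow> complex"
  assumes "f \<in> borel_measurable M" "g \<in> borel_measurable M"
    and f: "integrable M (\<lambda>\<omega>. (cmod (f \<omega>))\<^sup>2)" and g: "integrable M (\<lambda>\<omega>. (cmod (g \<omega>))\<^sup>2)"
  shows "integrable M (\<lambda>\<omega>. f \<omega> * g \<omega>)"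
proof (rule Bochner_Integration.integrable_bound)
  show "integrable M (\<lambda>\<omega>. (cmod (f \<omega>))\<^sup>2 + (cmod (g \<omega>))\<^sup>2)"
    using f g by simp
  have "x * y \<le> x\<^sup>2 + y\<^sup>2" if "x \<ge> 0" "y \<ge> 0" for x y :: real
    using sum_squares_bound[of x y] that mult_nonneg_nonneg[OF that] by linarith
  then show "AE \<omega> in M. norm (f \<omega> * g \<omega>) \<le> norm ((cmod (f \<omega>))\<^sup>2 + (cmod (g \<omega>))\<^sup>2)"
    by (simp add: norm_mult)
qed (use assms in measurable)

section \<open>Independence of variables with different value types, and second moments\<close>

context prob_space
begin

text \<open>The library's \<open>indep_var\<close> forces both variables to take values in the same type.\<close>
definition indep_rv :: "('a \<Rightarrow> 'b::topological_space) \<Rightarrow> ('a \<Rightarrow> 'c::topological_space) \<Rightarrow> bool" where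
  "indep_rv X Y \<longleftrightarrow> X \<in> borel_measurable M \<and> Y \<in> borel_measurable M \<and>
     (\<forall>f \<in> borel_measurable borel. \<forall>h \<in> borel_measurable borel.
        indep_var borel (\<lambda>\<omega>. f (X \<omega>) :: complex) borel (\<lambda>\<omega>. h (Y \<omega>) :: complex))"

lemma indep_rv_compose:
  assumes "indep_rv X Y" "f \<in> borel_measurable borel" "h \<in> borel_measurable borel"
  shows "indep_rv (\<lambda>\<omega>. f (X \<omega>)) (\<lambda>\<omega>. h (Y \<omega>))"
  unfolding indep_rv_def
proof (intro conjI ballI)
  show "(\<lambda>\<omega>. f (X \<omega>)) \<in> borel_measurable M" "(\<lambda>\<omega>. h (Y \<omega>)) \<in> borel_measurable M"
    using assms by (auto simp: indep_rv_def)
  show "indep_var borel (\<lambda>\<omega>. f' (f (X \<omega>)) :: complex) borel (\<lambda>\<omega>. h' (h (Y \<omega>)) :: complex)"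
    if "f' \<in> borel_measurable borel" "h' \<in> borel_measurable borel" for f' h'
    using assms that unfolding indep_rv_def
    by (auto dest!: bspec[of _ _ "\<lambda>x. f' (f x)"] dest: bspec[of _ _ "\<lambda>x. h' (h x)"])
qed

text \<open>Disjoint blocks of an independent family are independent, and so are functions of them.
  The two functions may differ in type, so a tuple of channel components can be compared with a
  single complex variable.\<close>

lemma indep_rv_disjoint:
  assumes "indep_vars (\<lambda>_. borel) X I" "A \<inter> B = {}" "A \<subseteq> I" "B \<subseteq> I"
    and f: "f \<in> borel_measurable (PiM A (\<lambda>_. borel))" and g: "g \<in> borel_measurable (PiM B (\<lambda>_. borel))"
  shows "indep_rv (\<lambda>\<omega>. f (restrict (\<lambda>i. X i \<omega>) A)) (\<lambda>\<omega>. g (restrict (\<lambda>i. X i \<omega>) B))"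
  unfolding indep_rv_def
proof (intro conjI ballI)
  have X: "\<And>i. i \<in> I \<Longrightarrow> X i \<in> borel_measurable M"
    using assms(1) by (simp add: indep_vars_def)
  show "(\<lambda>\<omega>. f (restrict (\<lambda>i. X i \<omega>) A)) \<in> borel_measurable M"
    by (rule measurable_compose[OF _ f]) (use X assms in \<open>auto intro!: measurable_restrict\<close>)
  show "(\<lambda>\<omega>. g (restrict (\<lambda>i. X i \<omega>) B)) \<in> borel_measurable M"
    by (rule measurable_compose[OF _ g]) (use X assms in \<open>auto intro!: measurable_restrict\<close>)
  show "indep_var borel (\<lambda>\<omega>. f' (f (restrict (\<lambda>i. X i \<omega>) A)) :: complex)
      borel (\<lambda>\<omega>. h' (g (restrict (\<lambda>i. X i \<omega>) B)) :: complex)"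
    if "f' \<in> borel_measurable borel" "h' \<in> borel_measurable borel" for f' h'
    using indep_var_compose[OF indep_var_restrict[OF assms(1-4)]
        measurable_compose[OF f that(1)] measurable_compose[OF g that(2)]]
    by (simp add: comp_def)
qed

lemma indep_rv_has_bochner_integral_mult:
  fixes f :: "'b::topological_space \<Rightarrow> complex" and h :: "'c::topological_space \<Rightarrow> complex"
  assumes "indep_rv X Y"
    and "f \<in> borel_measurable borel" "h \<in> borel_measurable borel"
    and "has_bochner_integral M (\<lambda>\<omega>. f (X \<omega>)) x" "has_bochner_integral M (\<lambda>\<omega>. h (Y \<omega>)) y"
  shows "has_bochner_integral M (\<lambda>\<omega>. f (X \<omega>) * h (Y \<omega>)) (x * y)"
proof -
  have "indep_var borel (\<lambda>\<omega>. f (X \<omega>)) borel (\<lambda>\<omega>. h (Y \<omega>))"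
    using assms(1-3) by (auto simp: indep_rv_def)
  from indep_var_lebesgue_integral[OF this] indep_var_integrable[OF this] assms(4,5)
  show ?thesis by (auto simp: has_bochner_integral_iff)
qed

text \<open>In the double sum for the squared modulus, independence and zero means remove the
  off-diagonal terms, and the diagonal terms are the variances. The expansion is complex-valued, so
  real parts are taken at the end.\<close>

lemma indep_vars_sum_second_moment:
  fixes Z :: "'i \<Rightarrow> 'a \<Rightarrow> complex"
  assumes fin: "finite I" and ind: "indep_vars (\<lambda>_. borel) Z I"
    and mean: "\<And>i. i \<in> I \<Longrightarrow> has_bochner_integral M (Z i) 0"
    and var: "\<And>i. i \<in> I \<Longrightarrow> has_bochner_integral M (\<lambda>\<omega>. (cmod (Z i \<omega>))\<^sup>2) (V i)"
  shows "has_bochner_integral M (\<lambda>\<omega>. \<Sum>i\<in>I. Z i \<omega>) 0"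
    and "has_bochner_integral M (\<lambda>\<omega>. (cmod (\<Sum>i\<in>I. Z i \<omega>))\<^sup>2) (\<Sum>i\<in>I. V i)"
proof -
  show "has_bochner_integral M (\<lambda>\<omega>. \<Sum>i\<in>I. Z i \<omega>) 0"
    using has_bochner_integral_sum[of I M Z "\<lambda>_. 0"] mean by simp
  have *: "has_bochner_integral M (\<lambda>\<omega>. Z i \<omega> * cnj (Z j \<omega>)) (if i = j then of_real (V i) else 0)"
    if "i \<in> I" "j \<in> I" for i j
  proof (cases "i = j")
    case True
    then show ?thesis
      using has_bochner_integral_of_real[OF var[OF that(1)], where 'a = complex]
      by (simp only: complex_norm_square simp_thms if_True)
  next
    case False
    have "indep_rv (Z i) (Z j)"
      using indep_rv_disjoint[OF ind, of "{i}" "{j}" "\<lambda>x. x i" "\<lambda>x. x j"] False that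
      by simp
    from indep_rv_has_bochner_integral_mult[OF this, of "\<lambda>x. x" cnj 0 "cnj 0"]
      mean that has_bochner_integral_cnj[OF mean[OF that(2)]]
    show ?thesis using False by simp
  qed
  have "has_bochner_integral M (\<lambda>\<omega>. \<Sum>i\<in>I. \<Sum>j\<in>I. Z i \<omega> * cnj (Z j \<omega>))
      (\<Sum>i\<in>I. \<Sum>j\<in>I. if i = j then of_real (V i) else 0)"
    by (intro has_bochner_integral_sum *)
  moreover have "(\<Sum>i\<in>I. \<Sum>j\<in>I. Z i \<omega> * cnj (Z j \<omega>)) = of_real ((cmod (\<Sum>i\<in>I. Z i \<omega>))\<^sup>2)" for \<omega>
    by (simp only: complex_norm_square cnj_sum sum_product)
  moreover have "(\<Sum>i\<in>I. \<Sum>j\<in>I. if i = j then of_real (V i) else 0) = complex_of_real (\<Sum>i\<in>I. V i)"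
    using fin by simp
  ultimately have "has_bochner_integral M (\<lambda>\<omega>. complex_of_real ((cmod (\<Sum>i\<in>I. Z i \<omega>))\<^sup>2))
      (complex_of_real (\<Sum>i\<in>I. V i))"
    by (simp only:)
  from has_bochner_integral_Re[OF this]
  show "has_bochner_integral M (\<lambda>\<omega>. (cmod (\<Sum>i\<in>I. Z i \<omega>))\<^sup>2) (\<Sum>i\<in>I. V i)"
    by (simp only: Re_complex_of_real)
qed

text \<open>The cross term \<open>cnj U * V * r\<close> has mean 0 because \<open>r\<close> is
  centred and independent of the pair. Independence is asked of the pair jointly, since
  \<open>U\<close> and \<open>V\<close> may depend on each other.\<close>

lemma indep_rv_affine_second_moment:
  fixes U V r :: "'a \<Rightarrow> complex"
  assumes ind: "indep_rv (\<lambda>\<omega>. (U \<omega>, V \<omega>)) r"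
    and U: "has_bochner_integral M (\<lambda>\<omega>. (cmod (U \<omega>))\<^sup>2) u"
    and V: "has_bochner_integral M (\<lambda>\<omega>. (cmod (V \<omega>))\<^sup>2) v"
    and r: "has_bochner_integral M r 0" "has_bochner_integral M (\<lambda>\<omega>. (cmod (r \<omega>))\<^sup>2) \<rho>"
  shows "has_bochner_integral M (\<lambda>\<omega>. (cmod (U \<omega> + V \<omega> * r \<omega>))\<^sup>2) (u + v * \<rho>)"
proof -
  have meas: "(\<lambda>\<omega>. (U \<omega>, V \<omega>)) \<in> borel_measurable M"
    using ind by (simp add: indep_rv_def)
  have [measurable]: "U \<in> borel_measurable M" "V \<in> borel_measurable M"
    using measurable_compose[OF meas, of fst borel] measurable_compose[OF meas, of snd borel]
    by simp_all
  \<comment> \<open>Only integrability matters here: whatever the mean of this product is, it gets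
    multiplied by the mean 0 of \<open>r\<close>.\<close>
  have "integrable M (\<lambda>\<omega>. cnj (U \<omega>) * V \<omega>)"
    by (rule integrable_square_cmod_mult) (use U V in \<open>auto simp: has_bochner_integral_iff\<close>)
  then have UV: "has_bochner_integral M (\<lambda>\<omega>. cnj (U \<omega>) * V \<omega>) (\<integral>\<omega>. cnj (U \<omega>) * V \<omega> \<partial>M)"
    by (rule has_bochner_integral_integrable)
  have 1: "has_bochner_integral M (\<lambda>\<omega>. cnj (U \<omega>) * V \<omega> * r \<omega>) 0"
    using indep_rv_has_bochner_integral_mult[OF ind, of "\<lambda>z. cnj (fst z) * snd z" "\<lambda>z. z"] UV r(1)
    by fastforce
  have 2: "has_bochner_integral M (\<lambda>\<omega>. (cmod (V \<omega>))\<^sup>2 * (cmod (r \<omega>))\<^sup>2) (v * \<rho>)"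
    using has_bochner_integral_Re[OF indep_rv_has_bochner_integral_mult[OF ind,
        of "\<lambda>z. of_real ((cmod (snd z))\<^sup>2)" "\<lambda>z. of_real ((cmod z)\<^sup>2)" "of_real v" "of_real \<rho>"]]
      has_bochner_integral_of_real[OF V] has_bochner_integral_of_real[OF r(2)]
    by simp
  have eq: "(cmod (x + y * z))\<^sup>2 = ((cmod x)\<^sup>2 + (cmod y)\<^sup>2 * (cmod z)\<^sup>2) + 2 * Re (cnj x * y * z)"
    for x y z :: complex
    by (simp add: cmod_power2) algebra
  show ?thesis
    unfolding eq
    using has_bochner_integral_add[OF has_bochner_integral_add[OF U 2]
        has_bochner_integral_mult_right[OF has_bochner_integral_Re[OF 1], of 2]] by simp
qed

end

section \<open>Hermitian products with white Gaussian vectors\<close>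

lemma borel_measurable_herm_prod [measurable]: "herm_prod u \<in> borel_measurable borel"
  unfolding herm_prod_def by (intro borel_measurable_continuous_onI continuous_intros)

text \<open>The coordinates are independent under the product law, so the Hermitian product is a sum
  of independent centred terms with weights \<open>cnj (u $ i)\<close>, and the variances add
  up.\<close>

lemma complex_normal_vec_herm_prod_moments:
  fixes u :: "complex ^ 'n::finite"
  assumes v: "v \<ge> 0"
  shows complex_normal_vec_herm_prod_mean:
      "has_bochner_integral (complex_normal_vec v) (herm_prod u) 0"
    and complex_normal_vec_herm_prod_variance:
      "has_bochner_integral (complex_normal_vec v) (\<lambda>x. (cmod (herm_prod u x))\<^sup>2) ((norm u)\<^sup>2 * v)"
proof -
  interpret C: prob_space "complex_normal v" by (rule prob_space_complex_normal)
  interpret P: product_prob_space "\<lambda>_. complex_normal v" "UNIV :: 'n set" ..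
  let ?P = "\<Pi>\<^sub>M i\<in>(UNIV :: 'n set). complex_normal v"
  have vec [measurable]: "(\<lambda>x. \<chi> i. x i) \<in> ?P \<rightarrow>\<^sub>M (borel :: (complex ^ 'n) measure)"
    by (subst borel_measurable_euclidean_space) (simp add: inner_vec_def)
  have comp: "distr ?P borel (\<lambda>x. x i) = complex_normal v" for i
  proof -
    have "distr ?P borel (\<lambda>x. x i) = distr ?P (complex_normal v) (\<lambda>x. x i)"
      by (rule distr_cong) simp_all
    then show ?thesis using P.PiM_component[of i] by simp
  qed
  \<comment> \<open>Independence is read off from the joint law being the product of the marginals,
    which \<open>comp\<close> identifies.\<close>
  have ind: "P.indep_vars (\<lambda>_. borel) (\<lambda>i x. x i) UNIV"
  proof (subst P.indep_vars_iff_distr_eq_PiM')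
    show "P.random_variable borel (\<lambda>x. x i)" for i :: 'n
      by simp
    have "distr ?P (\<Pi>\<^sub>M i\<in>(UNIV :: 'n set). borel) (\<lambda>x. x) = ?P"
      by (rule distr_id2) (rule sets_PiM_cong, simp_all)
    then show "distr ?P (\<Pi>\<^sub>M i\<in>UNIV. borel) (\<lambda>x. \<lambda>i\<in>UNIV. x i)
        = (\<Pi>\<^sub>M i\<in>(UNIV :: 'n set). distr ?P borel (\<lambda>x. x i))"
      unfolding comp by (simp add: restrict_UNIV)
  qed simp
  have ind': "P.indep_vars (\<lambda>_. borel) (\<lambda>i x. cnj (u $ i) * x i) UNIV"
    by (rule P.indep_vars_compose2[OF ind]) simp
  have trans: "has_bochner_integral ?P (\<lambda>x. f (x i)) c"
    if "has_bochner_integral (complex_normal v) f c" for i and c :: "'b::{banach, second_countable_topology}" and f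
  proof -
    have [measurable]: "f \<in> borel_measurable borel"
      using borel_measurable_has_bochner_integral[OF that]
        measurable_cong_sets[OF sets_complex_normal refl] by metis
    show ?thesis
      using that integrable_distr_eq[of "\<lambda>x. x i" ?P borel f] integral_distr[of "\<lambda>x. x i" ?P borel f]
      by (simp add: has_bochner_integral_iff comp)
  qed
  have "has_bochner_integral ?P (\<lambda>x. cnj (u $ i) * x i) 0" for i
    using has_bochner_integral_mult_right[OF trans[OF complex_normal_mean[OF v]], of "cnj (u $ i)"] by simp
  moreover have "has_bochner_integral ?P (\<lambda>x. (cmod (cnj (u $ i) * x i))\<^sup>2) ((cmod (u $ i))\<^sup>2 * v)" for i
    using has_bochner_integral_mult_right[OF trans[OF complex_normal_variance[OF v]], of "(cmod (u $ i))\<^sup>2"]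
    by (simp add: norm_mult power_mult_distrib)
  ultimately have "has_bochner_integral ?P (\<lambda>x. \<Sum>i\<in>UNIV. cnj (u $ i) * x i) 0"
    "has_bochner_integral ?P (\<lambda>x. (cmod (\<Sum>i\<in>UNIV. cnj (u $ i) * x i))\<^sup>2) (\<Sum>i\<in>UNIV. (cmod (u $ i))\<^sup>2 * v)"
    using P.indep_vars_sum_second_moment[OF finite ind',
        where V = "\<lambda>i. (cmod (u $ i))\<^sup>2 * v"] by auto
  then show "has_bochner_integral (complex_normal_vec v) (herm_prod u) 0"
    "has_bochner_integral (complex_normal_vec v) (\<lambda>x. (cmod (herm_prod u x))\<^sup>2) ((norm u)\<^sup>2 * v)"
    unfolding complex_normal_vec_def has_bochner_integral_iff
    by (simp_all add: integrable_distr_eq integral_distr)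
      (simp_all add: herm_prod_def norm_vec_def L2_set_def sum_nonneg sum_distrib_right)
qed

text \<open>The terms are grouped by their dependence on \<open>g\<close>, one group for each
  available moment. With \<open>g\<close> centred circular Gaussian and independent of
  \<open>(a, b)\<close>, the groups in g, |g|^2 g and g^2 average to 0, while the last one yields
  the cross term 2 d v Re m.\<close>

lemma square_cmod_mult_affine_expansion:
  fixes a b g :: complex
  shows "(cmod (cnj (a + g) * (b + of_real d * g)))\<^sup>2 =
      (cmod a)\<^sup>2 * (cmod b)\<^sup>2 + ((cmod a)\<^sup>2 * d\<^sup>2 + (cmod b)\<^sup>2) * (cmod g)\<^sup>2 + d\<^sup>2 * cmod g ^ 4
    + Re ((of_real (2 * d * (cmod a)\<^sup>2) * cnj b + of_real (2 * (cmod b)\<^sup>2) * cnj a) * g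
      + (of_real (2 * d) * cnj b + of_real (2 * d\<^sup>2) * cnj a) * (of_real ((cmod g)\<^sup>2) * g)
      + of_real (2 * d) * (cnj a * cnj b) * g\<^sup>2
      + of_real (2 * d) * (cnj a * b) * of_real ((cmod g)\<^sup>2))"
proof -
  have *: "cmod g ^ 4 = ((cmod g)\<^sup>2)\<^sup>2" by simp
  show ?thesis
    unfolding norm_mult power_mult_distrib complex_mod_cnj * cmod_power2
    by (simp add: power2_eq_square) algebra
qed

section \<open>Moments of a channel times an estimate correlated with it\<close>

context prob_space
begin

text \<open>The expectation is resolved in two stages: first \<open>g\<close> against
  \<open>(a, b)\<close>, then \<open>r\<close> against \<open>(a, b, g)\<close>. In the product
  \<open>r\<close> carries the random factor \<open>cnj (a + g)\<close>, so the second stage is an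
  instance of \<open>indep_rv_affine_second_moment\<close>.\<close>

lemma correlated_product_moments:
  fixes a b g r :: "'a \<Rightarrow> complex" and m :: complex and d \<alpha> \<gamma> v \<rho> :: real
  assumes ab_g: "indep_rv (\<lambda>\<omega>. (a \<omega>, b \<omega>)) g"
    and abg_r: "indep_rv (\<lambda>\<omega>. (a \<omega>, b \<omega>, g \<omega>)) r"
    and a: "\<And>\<omega>. cmod (a \<omega>) = \<alpha>" and b: "\<And>\<omega>. cmod (b \<omega>) = \<gamma>"
    and ab: "has_bochner_integral M (\<lambda>\<omega>. cnj (a \<omega>) * b \<omega>) m"
    and g1: "has_bochner_integral M g 0"
    and g2: "has_bochner_integral M (\<lambda>\<omega>. (g \<omega>)\<^sup>2) 0"
    and gv: "has_bochner_integral M (\<lambda>\<omega>. (cmod (g \<omega>))\<^sup>2) v"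
    and g3: "has_bochner_integral M (\<lambda>\<omega>. of_real ((cmod (g \<omega>))\<^sup>2) * g \<omega>) 0"
    and g4: "has_bochner_integral M (\<lambda>\<omega>. cmod (g \<omega>) ^ 4) (2 * v\<^sup>2)"
    and r1: "has_bochner_integral M r 0"
    and rv: "has_bochner_integral M (\<lambda>\<omega>. (cmod (r \<omega>))\<^sup>2) \<rho>"
  shows "has_bochner_integral M (\<lambda>\<omega>. cnj (a \<omega> + g \<omega>) * (b \<omega> + of_real d * g \<omega> + r \<omega>)) (m + of_real (d * v))"
    (is ?mean)
    and "has_bochner_integral M (\<lambda>\<omega>. (cmod (b \<omega> + of_real d * g \<omega> + r \<omega>))\<^sup>2) (\<gamma>\<^sup>2 + d\<^sup>2 * v + \<rho>)" (is ?second)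
    and "has_bochner_integral M (\<lambda>\<omega>. (cmod (cnj (a \<omega> + g \<omega>) * (b \<omega> + of_real d * g \<omega> + r \<omega>)))\<^sup>2)
      ((\<alpha>\<^sup>2 + v) * (\<gamma>\<^sup>2 + d\<^sup>2 * v + \<rho>) + d\<^sup>2 * v\<^sup>2 + 2 * d * v * Re m)" (is ?fourth)
proof -
  have abg: "(\<lambda>\<omega>. (a \<omega>, b \<omega>, g \<omega>)) \<in> borel_measurable M" and [measurable]: "r \<in> borel_measurable M"
    using abg_r by (simp_all add: indep_rv_def)
  have [measurable]: "a \<in> borel_measurable M" "b \<in> borel_measurable M" "g \<in> borel_measurable M"
    using measurable_compose[OF abg, of fst borel] measurable_compose[OF abg, of "\<lambda>x. fst (snd x)" borel]
      measurable_compose[OF abg, of "\<lambda>x. snd (snd x)" borel] by simp_all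
  \<comment> \<open>Constant moduli make every polynomial in \<open>a\<close>, \<open>b\<close> and
    their conjugates bounded, hence integrable.\<close>
  have bnd: "has_bochner_integral M f (integral\<^sup>L M f)"
    if "f \<in> borel_measurable M" "\<And>\<omega>. cmod (f \<omega>) \<le> K" for K and f :: "'a \<Rightarrow> complex"
    by (rule has_bochner_integral_integrable, rule integrable_const_bound[of _ K])
      (use that in auto)
  note mult = indep_rv_has_bochner_integral_mult[OF ab_g]
  \<comment> \<open>Serves both vanishing groups of the expansion, with \<open>h z\<close> equal to
    z and to |z|^2 z.\<close>
  have lin_g: "has_bochner_integral M (\<lambda>\<omega>. (of_real x * cnj (b \<omega>) + of_real y * cnj (a \<omega>)) * h (g \<omega>)) 0"
    if h: "h \<in> borel_measurable borel" "has_bochner_integral M (\<lambda>\<omega>. h (g \<omega>)) 0" for x y h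
  proof -
    have "has_bochner_integral M (\<lambda>\<omega>. of_real x * cnj (b \<omega>) + of_real y * cnj (a \<omega>))
        (\<integral>\<omega>. of_real x * cnj (b \<omega>) + of_real y * cnj (a \<omega>) \<partial>M)"
    proof (rule bnd)
      show "cmod (of_real x * cnj (b \<omega>) + of_real y * cnj (a \<omega>)) \<le> \<bar>x\<bar> * \<gamma> + \<bar>y\<bar> * \<alpha>" for \<omega>
        by (rule norm_triangle_le) (simp add: norm_mult a b)
    qed measurable
    from mult[of "\<lambda>z. of_real x * cnj (snd z) + of_real y * cnj (fst z)" h, OF _ h(1) _ h(2)] this
    show ?thesis by simp
  qed
  have ab_g2: "has_bochner_integral M (\<lambda>\<omega>. cnj (a \<omega>) * cnj (b \<omega>) * (g \<omega>)\<^sup>2) 0"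
  proof -
    have "has_bochner_integral M (\<lambda>\<omega>. cnj (a \<omega>) * cnj (b \<omega>)) (\<integral>\<omega>. cnj (a \<omega>) * cnj (b \<omega>) \<partial>M)"
    proof (rule bnd)
      show "cmod (cnj (a \<omega>) * cnj (b \<omega>)) \<le> \<alpha> * \<gamma>" for \<omega>
        by (simp add: norm_mult a b)
    qed measurable
    from mult[of "\<lambda>z. cnj (fst z) * cnj (snd z)" "\<lambda>z. z\<^sup>2", OF _ _ _ g2] this
    show ?thesis by simp
  qed
  have ab_gv: "has_bochner_integral M (\<lambda>\<omega>. cnj (a \<omega>) * b \<omega> * of_real ((cmod (g \<omega>))\<^sup>2)) (m * of_real v)"
    using mult[of "\<lambda>z. cnj (fst z) * snd z" "\<lambda>z. of_real ((cmod z)\<^sup>2)", OF _ _ _ has_bochner_integral_of_real[OF gv]]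
      ab by simp
  note add = has_bochner_integral_add and cmult = has_bochner_integral_mult_right
  have const: "has_bochner_integral M (\<lambda>_. c) c" for c :: "'b::{banach, second_countable_topology}"
    by (simp add: has_bochner_integral_iff prob_space)

  let ?U = "\<lambda>\<omega>. cnj (a \<omega> + g \<omega>) * (b \<omega> + of_real d * g \<omega>)"
  have U: "has_bochner_integral M (\<lambda>\<omega>. (cmod (?U \<omega>))\<^sup>2)
     (\<alpha>\<^sup>2 * \<gamma>\<^sup>2 + (\<alpha>\<^sup>2 * d\<^sup>2 + \<gamma>\<^sup>2) * v + d\<^sup>2 * (2 * v\<^sup>2) + 2 * d * v * Re m)"
    unfolding square_cmod_mult_affine_expansion a b
    using add[OF add[OF add[OF const[of "\<alpha>\<^sup>2 * \<gamma>\<^sup>2"] cmult[OF gv, of "\<alpha>\<^sup>2 * d\<^sup>2 + \<gamma>\<^sup>2"]] cmult[OF g4, of "d\<^sup>2"]]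
        has_bochner_integral_Re[OF add[OF add[OF add[OF
          lin_g[of "\<lambda>z. z" "2 * d * \<alpha>\<^sup>2" "2 * \<gamma>\<^sup>2", OF _ g1]
          lin_g[of "\<lambda>z. of_real ((cmod z)\<^sup>2) * z" "2 * d" "2 * d\<^sup>2", OF _ g3]]
          cmult[OF ab_g2, of "of_real (2 * d)"]] cmult[OF ab_gv, of "of_real (2 * d)"]]]]
    by (simp add: mult_ac)
  \<comment> \<open>The second components are the factors of \<open>g\<close> in
    \<open>a + g\<close> and \<open>b + d * g\<close>, constants in the role of
    \<open>V\<close>.\<close>
  have ab_g': "indep_rv (\<lambda>\<omega>. (a \<omega>, 1)) g" "indep_rv (\<lambda>\<omega>. (b \<omega>, of_real d)) g"
    using indep_rv_compose[OF ab_g, of "\<lambda>z. (fst z, 1)" "\<lambda>z. z"]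
      indep_rv_compose[OF ab_g, of "\<lambda>z. (snd z, of_real d)" "\<lambda>z. z"]
    by (simp_all add: borel_measurable_continuous_onI continuous_intros)
  have V: "has_bochner_integral M (\<lambda>\<omega>. (cmod (a \<omega> + g \<omega>))\<^sup>2) (\<alpha>\<^sup>2 + v)"
    using indep_rv_affine_second_moment[OF ab_g'(1) _ _ g1 gv, of "\<alpha>\<^sup>2" 1] const[of "\<alpha>\<^sup>2"] const[of 1]
    by (simp add: a)
  have B: "has_bochner_integral M (\<lambda>\<omega>. (cmod (b \<omega> + of_real d * g \<omega>))\<^sup>2) (\<gamma>\<^sup>2 + d\<^sup>2 * v)"
    using indep_rv_affine_second_moment[OF ab_g'(2) _ _ g1 gv, of "\<gamma>\<^sup>2" "d\<^sup>2"] const[of "\<gamma>\<^sup>2"] const[of "d\<^sup>2"]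
    by (simp add: b)
  have abg_r': "indep_rv (\<lambda>\<omega>. (b \<omega> + of_real d * g \<omega>, 1)) r"
    "indep_rv (\<lambda>\<omega>. (?U \<omega>, cnj (a \<omega> + g \<omega>))) r"
    using indep_rv_compose[OF abg_r, of "\<lambda>z. (fst (snd z) + of_real d * snd (snd z), 1)" "\<lambda>z. z"]
      indep_rv_compose[OF abg_r, of "\<lambda>z. (cnj (fst z + snd (snd z)) * (fst (snd z) + of_real d * snd (snd z)),
        cnj (fst z + snd (snd z)))" "\<lambda>z. z"]
    by (simp_all add: borel_measurable_continuous_onI continuous_intros)
  show ?second
    using indep_rv_affine_second_moment[OF abg_r'(1) B _ r1 rv, of 1] const[of 1] by simp
  have "has_bochner_integral M (\<lambda>\<omega>. (cmod (cnj (a \<omega> + g \<omega>)))\<^sup>2) (\<alpha>\<^sup>2 + v)"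
    using V by (simp only: complex_mod_cnj)
  from indep_rv_affine_second_moment[OF abg_r'(2) U this r1 rv]
  have "has_bochner_integral M (\<lambda>\<omega>. (cmod (?U \<omega> + cnj (a \<omega> + g \<omega>) * r \<omega>))\<^sup>2)
     (\<alpha>\<^sup>2 * \<gamma>\<^sup>2 + (\<alpha>\<^sup>2 * d\<^sup>2 + \<gamma>\<^sup>2) * v + d\<^sup>2 * (2 * v\<^sup>2) + 2 * d * v * Re m + (\<alpha>\<^sup>2 + v) * \<rho>)" .
  \<comment> \<open>Since E |g|^4 = 2 v^2, one copy of d^2 v^2 completes the product of second
    moments and the other is the excess.\<close>
  moreover have "\<alpha>\<^sup>2 * \<gamma>\<^sup>2 + (\<alpha>\<^sup>2 * d\<^sup>2 + \<gamma>\<^sup>2) * v + d\<^sup>2 * (2 * v\<^sup>2) + 2 * d * v * Re m + (\<alpha>\<^sup>2 + v) * \<rho>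
     = (\<alpha>\<^sup>2 + v) * (\<gamma>\<^sup>2 + d\<^sup>2 * v + \<rho>) + d\<^sup>2 * v\<^sup>2 + 2 * d * v * Re m"
    by algebra
  moreover have "?U \<omega> + cnj (a \<omega> + g \<omega>) * r \<omega> = cnj (a \<omega> + g \<omega>) * (b \<omega> + of_real d * g \<omega> + r \<omega>)" for \<omega>
    by algebra
  ultimately show ?fourth by (simp only:)
  have "integrable M (\<lambda>\<omega>. cnj (a \<omega> + g \<omega>))"
    using g1 bnd[of a, OF _ eq_refl[OF a]] by (simp add: has_bochner_integral_iff)
  then have "has_bochner_integral M (\<lambda>\<omega>. cnj (a \<omega> + g \<omega>)) (\<integral>\<omega>. cnj (a \<omega> + g \<omega>) \<partial>M)"
    by (rule has_bochner_integral_integrable)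
  then have hr: "has_bochner_integral M (\<lambda>\<omega>. cnj (a \<omega> + g \<omega>) * r \<omega>) 0"
    using indep_rv_has_bochner_integral_mult[OF abg_r, of "\<lambda>z. cnj (fst z + snd (snd z))" "\<lambda>z. z",
        OF _ _ _ r1, of "\<integral>\<omega>. cnj (a \<omega> + g \<omega>) \<partial>M"]
    by (simp add: borel_measurable_continuous_onI continuous_intros)
  have bg: "has_bochner_integral M (\<lambda>\<omega>. b \<omega> * cnj (g \<omega>)) 0"
    using has_bochner_integral_cnj[OF lin_g[of "\<lambda>z. z" 1 0, OF _ g1]] by simp
  \<comment> \<open>The zero coefficient brings the term in \<open>cnj x * z\<close> into the shape
    of \<open>lin_g\<close>.\<close>
  have eq: "cnj (x + z) * (y + of_real d * z + w) =
     cnj x * y + of_real d * of_real ((cmod z)\<^sup>2) + (of_real 0 * cnj y + of_real d * cnj x) * z + y * cnj z + cnj (x + z) * w"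
    for x y z w :: complex
    unfolding complex_norm_square by (simp add: algebra_simps)
  show ?mean
    unfolding eq
    using add[OF add[OF add[OF add[OF ab cmult[OF has_bochner_integral_of_real[OF gv], of "of_real d"]]
        lin_g[of "\<lambda>z. z" 0 d, OF _ g1]] bg] hr]
    by simp
qed

end

section \<open>Channel and estimate\<close>

lemma has_law_has_bochner_integral:
  fixes f :: "'b::topological_space \<Rightarrow> 'c::{banach, second_countable_topology}"
  assumes "has_law P X \<mu>" "f \<in> borel_measurable borel" "has_bochner_integral \<mu> f c"
  shows "has_bochner_integral P (\<lambda>\<omega>. f (X \<omega>)) c"
  using assms integrable_distr_eq[of X P borel f] integral_distr[of X P borel f]
  by (simp add: has_law_def has_bochner_integral_iff)

lemma borel_measurable_cis [measurable]: "cis \<in> borel_measurable borel"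
  by (intro borel_measurable_continuous_onI continuous_intros)

text \<open>The integral runs over a full period: the antiderivative \<open>- \<i> * cis x\<close>
  agrees at both endpoints.\<close>

lemma uniform_cis_mean: "has_bochner_integral (uniform_measure lborel {- pi..pi}) cis 0"
proof -
  have "has_bochner_integral lborel (\<lambda>x. indicator {- pi..pi} x *\<^sub>R cis x) (- \<i> * cis pi - (- \<i> * cis (- pi)))"
  proof (rule has_bochner_integral_FTC_Icc)
    show "((\<lambda>x. - \<i> * cis x) has_vector_derivative cis x) (at x within {- pi..pi})" for x
      unfolding cis_conv_exp
      by (rule has_vector_derivative_real_field[THEN has_vector_derivative_at_within] derivative_eq_intros refl | simp)+
  qed (auto intro!: continuous_intros)
  then have "has_bochner_integral lborel (\<lambda>x. (1 / (2 * pi)) *\<^sub>R (indicator {- pi..pi} x *\<^sub>R cis x)) ((1 / (2 * pi)) *\<^sub>R 0)"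
    by (intro has_bochner_integral_scaleR_right) (simp add: cis.ctr complex_eq_iff)
  then have "has_bochner_integral lborel (\<lambda>x. (indicator {- pi..pi} x / (2 * pi)) *\<^sub>R cis x) 0"
    by (simp add: mult.commute)
  moreover have "uniform_measure lborel {- pi..pi} = density lborel (\<lambda>x. ennreal (indicator {- pi..pi} x / (2 * pi)))"
    unfolding uniform_measure_def
    by (rule density_cong) (auto simp: divide_ennreal indicator_def simp flip: ennreal_1)
  ultimately show ?thesis
    by (simp add: has_bochner_integral_density)
qed

text \<open>
  Each source of randomness is mapped to a complex variable (the pilot noise through its
  correlation with the pilot \<open>i\<close>), so that a single family of variables of one type captures
  their mutual independence.
\<close>
primrec source_value ::
  "('w, 'ap, 'ue, 'pl::finite) cf_system \<Rightarrow> 'pl \<Rightarrow> ('ap, 'ue) source \<Rightarrow> 'w \<Rightarrow> complex" where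
  "source_value S i (Phase m k) = (\<lambda>\<omega>. cis (phase S m k \<omega>))"
| "source_value S i (Scatter m k) = scatter S m k"
| "source_value S i (Pilot_Noise m) = (\<lambda>\<omega>. herm_prod (pilot_book S i) (pilot_noise S m \<omega>))"

lemma vimage_compose_in_vimage_algebra:
  assumes "f \<in> borel_measurable borel" "A \<in> sets borel"
  shows "(\<lambda>\<omega>. f (X \<omega>)) -` A \<inter> \<Omega> \<in> sets (vimage_algebra \<Omega> X borel)"
proof -
  have "(\<lambda>\<omega>. f (X \<omega>)) -` A \<inter> \<Omega> = X -` (f -` A) \<inter> \<Omega>"
    by auto
  then show ?thesis
    using in_vimage_algebra[OF measurable_sets_borel[OF assms]] by metis
qed

section \<open>Independence and moments of the sources of randomness\<close>

context cf_model
begin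

interpretation P: prob_space "prob_sp S"
  by (rule prob_space)

text \<open>Each value is a Borel function of its source, so it generates a subfamily of
  \<open>source_events\<close>, and independence passes to subfamilies.\<close>

lemma source_value_indep: "P.indep_vars (\<lambda>_. borel) (source_value S i) UNIV"
  unfolding P.indep_vars_def2
proof (intro conjI ballI)
  show "source_value S i s \<in> borel_measurable (prob_sp S)" for s
  proof (cases s)
    case (Phase m k)
    have [measurable]: "phase S m k \<in> borel_measurable (prob_sp S)"
      using phase_law by (simp add: has_law_def)
    show ?thesis using Phase by simp
  next
    case (Scatter m k)
    then show ?thesis using scatter_law by (simp add: has_law_def)
  next
    case (Pilot_Noise m)
    have [measurable]: "pilot_noise S m \<in> borel_measurable (prob_sp S)"
      using pilot_noise_law by (simp add: has_law_def)
    show ?thesis using Pilot_Noise by simp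
  qed
  have "{source_value S i s -` A \<inter> space (prob_sp S) |A. A \<in> sets borel} \<subseteq> source_events S s" for s
  proof (cases s)
    case (Scatter m k)
    then show ?thesis by (auto intro: in_vimage_algebra)
  qed (auto intro: vimage_compose_in_vimage_algebra)
  then show "P.indep_sets (\<lambda>s. {source_value S i s -` A \<inter> space (prob_sp S) |A. A \<in> sets borel}) UNIV"
    by (rule P.indep_sets_mono_sets[OF sources_independent])
qed

lemma phase_mean: "has_bochner_integral (prob_sp S) (source_value S i (Phase m k)) 0"
  unfolding source_value.simps
  by (rule has_law_has_bochner_integral[OF phase_law borel_measurable_cis uniform_cis_mean])

lemma pilot_noise_moments:
  shows "has_bochner_integral (prob_sp S) (source_value S i (Pilot_Noise m)) 0"
    and "has_bochner_integral (prob_sp S) (\<lambda>\<omega>. (cmod (source_value S i (Pilot_Noise m) \<omega>))\<^sup>2)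
      (pilot_len S * var_ul S)"
proof -
  have "has_bochner_integral (prob_sp S)
      (\<lambda>\<omega>. (cmod (herm_prod (pilot_book S i) (pilot_noise S m \<omega>)))\<^sup>2)
      ((norm (pilot_book S i))\<^sup>2 * var_ul S)"
    by (rule has_law_has_bochner_integral[OF pilot_noise_law _
          complex_normal_vec_herm_prod_variance[OF less_imp_le[OF var_ul_pos]]]) measurable
  then show "has_bochner_integral (prob_sp S)
      (\<lambda>\<omega>. (cmod (source_value S i (Pilot_Noise m) \<omega>))\<^sup>2) (pilot_len S * var_ul S)"
    by (simp add: pilot_norm pilot_len_def)
  show "has_bochner_integral (prob_sp S) (source_value S i (Pilot_Noise m)) 0"
    unfolding source_value.simps
    by (rule has_law_has_bochner_integral[OF pilot_noise_law _
          complex_normal_vec_herm_prod_mean[OF less_imp_le[OF var_ul_pos]]]) measurable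
qed

lemma scatter_moments:
  shows "has_bochner_integral (prob_sp S) (scatter S m k) 0"
    and "has_bochner_integral (prob_sp S) (\<lambda>\<omega>. (scatter S m k \<omega>)\<^sup>2) 0"
    and "has_bochner_integral (prob_sp S) (\<lambda>\<omega>. (cmod (scatter S m k \<omega>))\<^sup>2) (beta S m k)"
    and "has_bochner_integral (prob_sp S)
      (\<lambda>\<omega>. of_real ((cmod (scatter S m k \<omega>))\<^sup>2) * scatter S m k \<omega>) 0"
    and "has_bochner_integral (prob_sp S) (\<lambda>\<omega>. cmod (scatter S m k \<omega>) ^ 4) (2 * (beta S m k)\<^sup>2)"
proof -
  note transfer = has_law_has_bochner_integral[OF scatter_law]
  note moments = complex_normal_moments[OF less_imp_le[OF beta_pos]]
  show "has_bochner_integral (prob_sp S) (scatter S m k) 0"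
    by (rule transfer[OF _ moments(1)]) measurable
  show "has_bochner_integral (prob_sp S) (\<lambda>\<omega>. (scatter S m k \<omega>)\<^sup>2) 0"
    by (rule transfer[OF _ moments(2)]) measurable
  show "has_bochner_integral (prob_sp S) (\<lambda>\<omega>. (cmod (scatter S m k \<omega>))\<^sup>2) (beta S m k)"
    by (rule transfer[OF _ moments(3)]) measurable
  show "has_bochner_integral (prob_sp S)
      (\<lambda>\<omega>. of_real ((cmod (scatter S m k \<omega>))\<^sup>2) * scatter S m k \<omega>) 0"
    by (rule transfer[OF _ moments(4)]) measurable
  show "has_bochner_integral (prob_sp S) (\<lambda>\<omega>. cmod (scatter S m k \<omega>) ^ 4) (2 * (beta S m k)\<^sup>2)"
    by (rule transfer[OF _ moments(5)]) measurable
qed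

section \<open>Constants of the estimator and moments of the estimate\<close>

lemma pilot_len_pos: "pilot_len S > 0"
  by (simp add: pilot_len_def)

lemma lam_pos: "lam S m k > 0"
  unfolding lam_def
  by (intro add_nonneg_pos sum_nonneg mult_nonneg_nonneg var_ul_pos)
    (simp_all add: less_imp_le pilot_power_pos pilot_len_pos beta_pos)

text \<open>The factor in front of the centred pilot observation in \<open>h_mmse\<close>.\<close>

definition mmse_gain :: "'ap \<Rightarrow> 'ue \<Rightarrow> real" where
  "mmse_gain n l = sqrt (pilot_power S l) * beta S n l / lam S n l"

text \<open>The coefficient of \<open>scatter S n k\<close> inside \<open>h_mmse S n l\<close>, that
  is, the constant d of the general decomposition; for \<open>k = l\<close> it weighs the user's own
  scattering.\<close>

definition mmse_contamination :: "'ap \<Rightarrow> 'ue \<Rightarrow> 'ue \<Rightarrow> real" where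
  "mmse_contamination n k l =
     (if k \<in> copilot S l then mmse_gain n l * (sqrt (pilot_power S k) * pilot_len S) else 0)"

text \<open>The second moment of \<open>h_mmse S n l\<close>, and also the entry of
  \<open>Z_mat S l\<close> at access point \<open>n\<close>.\<close>

definition mmse_power :: "'ap \<Rightarrow> 'ue \<Rightarrow> real" where
  "mmse_power n l = pilot_power S l * pilot_len S * (beta S n l)\<^sup>2 / lam S n l + (los S n l)\<^sup>2"

lemma mmse_power_pos: "mmse_power n l > 0"
  unfolding mmse_power_def
  by (intro add_pos_nonneg divide_pos_pos mult_pos_pos zero_less_power)
    (simp_all add: pilot_power_pos pilot_len_pos beta_pos lam_pos)

lemma mmse_gain_square:
  "(mmse_gain n l)\<^sup>2 = pilot_power S l * (beta S n l)\<^sup>2 / (lam S n l)\<^sup>2"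
  using pilot_power_pos[of l] by (simp add: mmse_gain_def power_mult_distrib power_divide)

text \<open>The centred pilot observation has variance \<open>pilot_len S * lam S n l\<close>, so
  the left side is the variance of the random correction in the estimate.\<close>

lemma mmse_gain_lam:
  "(mmse_gain n l)\<^sup>2 * pilot_len S * lam S n l =
     pilot_power S l * pilot_len S * (beta S n l)\<^sup>2 / lam S n l"
proof -
  have "lam S n l \<noteq> 0"
    using lam_pos[of n l] by simp
  then have "x / (lam S n l)\<^sup>2 * t * lam S n l = t * x / lam S n l" for x t
    by (simp add: power2_eq_square)
  then show ?thesis
    by (simp only: mmse_gain_square mult_ac)
qed

lemma channel_mmse_moments:
  fixes n :: 'ap and k l :: 'ue
  defines "m \<equiv> if k = l then (los S n k)\<^sup>2 else 0" and "d \<equiv> mmse_contamination n k l"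
  shows "has_bochner_integral (prob_sp S) (\<lambda>\<omega>. cnj (channel S n k \<omega>) * h_mmse S n l \<omega>)
      (of_real (m + d * beta S n k))"
    and "has_bochner_integral (prob_sp S) (\<lambda>\<omega>. (cmod (h_mmse S n l \<omega>))\<^sup>2) (mmse_power n l)"
    and "has_bochner_integral (prob_sp S) (\<lambda>\<omega>. (cmod (cnj (channel S n k \<omega>) * h_mmse S n l \<omega>))\<^sup>2)
      (beta' S n k * mmse_power n l + d\<^sup>2 * (beta S n k)\<^sup>2 + 2 * d * beta S n k * m)"
proof -
  define c where "c = mmse_gain n l"
  let ?X = "source_value S (pilot_of S l)"
  \<comment> \<open>\<open>J\<close> collects the sources of the remainder \<open>r\<close>. Leaving
    out user \<open>k\<close> keeps it disjoint from the block of \<open>a\<close>, \<open>b\<close>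
    and \<open>scatter S n k\<close>, whether or not \<open>k\<close> shares the pilot of
    \<open>l\<close>.\<close>
  define J where "J = insert (Pilot_Noise n) (Scatter n ` (copilot S l - {k}))"
  let ?w = "\<lambda>i. sqrt (pilot_power S i) * pilot_len S"
  define wt :: "('ap, 'ue) source \<Rightarrow> real" where
    "wt s = (case s of Phase _ _ \<Rightarrow> 0 | Scatter _ i \<Rightarrow> c * ?w i | Pilot_Noise _ \<Rightarrow> c)" for s
  define a where "a \<omega> = of_real (los S n k) * ?X (Phase n k) \<omega>" for \<omega>
  define b where "b \<omega> = of_real (los S n l) * ?X (Phase n l) \<omega>" for \<omega>
  define r where "r \<omega> = (\<Sum>s\<in>J. of_real (wt s) * ?X s \<omega>)" for \<omega>
  let ?g = "scatter S n k"
  note X = source_value_indep[of "pilot_of S l"]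
  have sumJ: "(\<Sum>s\<in>J. f s) = f (Pilot_Noise n) + (\<Sum>i\<in>copilot S l - {k}. f (Scatter n i))"
    for f :: "('ap, 'ue) source \<Rightarrow> 'b::comm_monoid_add"
    unfolding J_def by (subst sum.insert) (auto simp: sum.reindex inj_on_def)
  have split: "(\<Sum>i\<in>copilot S l. f i) = (if k \<in> copilot S l then f k else 0) + (\<Sum>i\<in>copilot S l - {k}. f i)"
    for f :: "'ue \<Rightarrow> 'b::comm_monoid_add"
    by (auto intro: sum.remove)
  have ch: "channel S n k \<omega> = a \<omega> + ?g \<omega>" for \<omega>
    by (simp add: channel_def a_def)
  \<comment> \<open>The line-of-sight terms cancel, which leaves scattering and correlated
    noise.\<close>
  have "pilot_obs S n l \<omega> - pilot_obs_mean S n l \<omega> =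
      (\<Sum>i\<in>copilot S l. of_real (?w i) * scatter S n i \<omega>) + ?X (Pilot_Noise n) \<omega>" for \<omega>
    by (simp add: pilot_obs_def pilot_obs_mean_def channel_def algebra_simps sum.distrib)
  then have "h_mmse S n l \<omega> = b \<omega> + of_real c *
      ((\<Sum>i\<in>copilot S l. of_real (?w i) * scatter S n i \<omega>) + ?X (Pilot_Noise n) \<omega>)" for \<omega>
    by (simp add: h_mmse_def b_def c_def mmse_gain_def)
  then have h: "h_mmse S n l \<omega> = b \<omega> + of_real d * ?g \<omega> + r \<omega>" for \<omega>
    unfolding r_def sumJ split
    by (simp add: wt_def d_def mmse_contamination_def c_def algebra_simps sum_distrib_left)
  have ab_g: "P.indep_rv (\<lambda>\<omega>. (a \<omega>, b \<omega>)) ?g"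
    using P.indep_rv_disjoint[OF X, of "{Phase n k, Phase n l}" "{Scatter n k}"
      "\<lambda>x. (of_real (los S n k) * x (Phase n k), of_real (los S n l) * x (Phase n l))"
      "\<lambda>x. x (Scatter n k)"]
    by (simp add: a_def b_def)
  \<comment> \<open>Shows \<open>r\<close> as a function of the restriction to \<open>J\<close>, the
    form required by \<open>indep_rv_disjoint\<close>.\<close>
  have r: "r \<omega> = (\<Sum>s\<in>J. of_real (wt s) * restrict (\<lambda>s. ?X s \<omega>) J s)" for \<omega>
    unfolding r_def by (rule sum.cong) simp_all
  have abg_r: "P.indep_rv (\<lambda>\<omega>. (a \<omega>, b \<omega>, ?g \<omega>)) r"
  proof -
    let ?A = "{Phase n k, Phase n l, Scatter n k}"
    let ?f = "\<lambda>x. (complex_of_real (los S n k) * x (Phase n k), of_real (los S n l) * x (Phase n l), x (Scatter n k))"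
    let ?h = "\<lambda>x. \<Sum>s\<in>J. complex_of_real (wt s) * x s"
    have disj: "?A \<inter> J = {}" by (auto simp: J_def)
    have f: "?f \<in> borel_measurable (PiM ?A (\<lambda>_. borel))"
      by (intro borel_measurable_Pair borel_measurable_times borel_measurable_const
          measurable_component_singleton insertI1 insertI2)
    have h: "?h \<in> borel_measurable (PiM J (\<lambda>_. borel))"
      by (intro borel_measurable_sum borel_measurable_times borel_measurable_const
          measurable_component_singleton)
    from P.indep_rv_disjoint[OF X disj subset_UNIV subset_UNIV f h] show ?thesis
      unfolding r[symmetric] by (simp add: a_def b_def)
  qed
  have wX: "P.indep_vars (\<lambda>_. borel) (\<lambda>s \<omega>. of_real (wt s) * ?X s \<omega>) J"
    by (rule P.indep_vars_compose2[OF P.indep_vars_subset[OF X]]) simp_all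
  define V where "V s = (wt s)\<^sup>2 *
      (case s of Scatter m i \<Rightarrow> beta S m i | _ \<Rightarrow> pilot_len S * var_ul S)" for s
  have wX_moments: "has_bochner_integral (prob_sp S) (\<lambda>\<omega>. of_real (wt s) * ?X s \<omega>) 0"
    "has_bochner_integral (prob_sp S) (\<lambda>\<omega>. (cmod (of_real (wt s) * ?X s \<omega>))\<^sup>2) (V s)"
    if "s \<in> J" for s
  proof -
    have 1: "has_bochner_integral (prob_sp S) (?X s) 0"
      and 2: "has_bochner_integral (prob_sp S) (\<lambda>\<omega>. (cmod (?X s \<omega>))\<^sup>2)
        (case s of Scatter m i \<Rightarrow> beta S m i | _ \<Rightarrow> pilot_len S * var_ul S)"
      using that pilot_noise_moments[of "pilot_of S l" n] scatter_moments(1,3)[of n]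
      by (auto simp: J_def)
    show "has_bochner_integral (prob_sp S) (\<lambda>\<omega>. of_real (wt s) * ?X s \<omega>) 0"
      using has_bochner_integral_mult_right[OF 1, of "of_real (wt s)"] by simp
    show "has_bochner_integral (prob_sp S) (\<lambda>\<omega>. (cmod (of_real (wt s) * ?X s \<omega>))\<^sup>2) (V s)"
      using has_bochner_integral_mult_right[OF 2, of "(wt s)\<^sup>2"]
      by (simp add: V_def norm_mult power_mult_distrib)
  qed
  have "finite J" by (simp add: J_def)
  note r1 = P.indep_vars_sum_second_moment(1)[OF this wX wX_moments, folded r_def]
    and rv = P.indep_vars_sum_second_moment(2)[OF this wX wX_moments, folded r_def]
  have w2: "(?w i)\<^sup>2 = pilot_power S i * (pilot_len S)\<^sup>2" for i
    using pilot_power_pos[of i] by (simp add: power_mult_distrib)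
  \<comment> \<open>The share of user \<open>k\<close>, held in \<open>d\<close>, and the remainder
    together restore the full sum in \<open>lam\<close>. If \<open>k\<close> is outside the pilot
    group, then \<open>d = 0\<close> and nothing was removed from the sum.\<close>
  have "d\<^sup>2 * beta S n k + (\<Sum>s\<in>J. V s) =
      c\<^sup>2 * ((\<Sum>i\<in>copilot S l. (?w i)\<^sup>2 * beta S n i) + pilot_len S * var_ul S)"
    unfolding sumJ split V_def
    by (simp add: wt_def d_def mmse_contamination_def c_def power_mult_distrib sum_distrib_left algebra_simps)
  also have "\<dots> = c\<^sup>2 * pilot_len S * lam S n l"
    unfolding w2 lam_def by (simp add: algebra_simps sum_distrib_left power2_eq_square)
  finally have "d\<^sup>2 * beta S n k + (\<Sum>s\<in>J. V s) = c\<^sup>2 * pilot_len S * lam S n l" .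
  then have power: "(los S n l)\<^sup>2 + d\<^sup>2 * beta S n k + (\<Sum>s\<in>J. V s) = mmse_power n l"
    by (simp add: mmse_power_def c_def mmse_gain_lam)
  \<comment> \<open>For \<open>k = l\<close> the phase cancels against its conjugate; otherwise two
    independent centred phases are multiplied.\<close>
  have ab: "has_bochner_integral (prob_sp S) (\<lambda>\<omega>. cnj (a \<omega>) * b \<omega>) (of_real m)"
  proof (cases "k = l")
    case True
    have "cnj (a \<omega>) * b \<omega> = of_real m" for \<omega>
      using True by (simp add: a_def b_def m_def power2_eq_square cis_cnj cis_mult)
    then show ?thesis
      by (simp add: has_bochner_integral_iff P.prob_space)
  next
    case False
    have "P.indep_rv (?X (Phase n k)) (?X (Phase n l))"
      using P.indep_rv_disjoint[OF X, of "{Phase n k}" "{Phase n l}" "\<lambda>x. x (Phase n k)"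
        "\<lambda>x. x (Phase n l)"] False by simp
    moreover have "has_bochner_integral (prob_sp S) (\<lambda>\<omega>. cnj (of_real (los S n k) * ?X (Phase n k) \<omega>)) 0"
      using has_bochner_integral_cnj[OF has_bochner_integral_mult_right[OF phase_mean,
          of "of_real (los S n k)"]] by simp
    moreover have "has_bochner_integral (prob_sp S) (\<lambda>\<omega>. of_real (los S n l) * ?X (Phase n l) \<omega>) 0"
      using has_bochner_integral_mult_right[OF phase_mean, of "of_real (los S n l)"] by simp
    ultimately have "has_bochner_integral (prob_sp S)
        (\<lambda>\<omega>. cnj (of_real (los S n k) * ?X (Phase n k) \<omega>) * (of_real (los S n l) * ?X (Phase n l) \<omega>)) (0 * 0)"
      by (intro P.indep_rv_has_bochner_integral_mult[where f = "\<lambda>z. cnj (of_real (los S n k) * z)"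
            and h = "\<lambda>z. of_real (los S n l) * z"]) simp_all
    then show ?thesis using False by (simp add: a_def b_def m_def)
  qed
  have "cmod (a \<omega>) = los S n k" "cmod (b \<omega>) = los S n l" for \<omega>
    using los_nonneg by (simp_all add: a_def b_def norm_mult)
  \<comment> \<open>Unfolding \<open>power\<close> collapses the second moment of the estimate to
    \<open>mmse_power\<close>, which no longer depends on \<open>k\<close>.\<close>
  note moments = P.correlated_product_moments[OF ab_g abg_r this ab scatter_moments r1 rv, of d,
    unfolded power, folded ch h]
  show "has_bochner_integral (prob_sp S) (\<lambda>\<omega>. cnj (channel S n k \<omega>) * h_mmse S n l \<omega>)
      (of_real (m + d * beta S n k))"
    using moments(1) by (simp only: of_real_add)
  show "has_bochner_integral (prob_sp S) (\<lambda>\<omega>. (cmod (h_mmse S n l \<omega>))\<^sup>2) (mmse_power n l)"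
    using moments(2) .
  show "has_bochner_integral (prob_sp S) (\<lambda>\<omega>. (cmod (cnj (channel S n k \<omega>) * h_mmse S n l \<omega>))\<^sup>2)
      (beta' S n k * mmse_power n l + d\<^sup>2 * (beta S n k)\<^sup>2 + 2 * d * beta S n k * m)"
    using moments(3)
    unfolding beta'_def Re_complex_of_real add.commute[of "beta S n k" "(los S n k)\<^sup>2"] .
qed

end

section \<open>Diagonal matrices and the SINR\<close>

lemma diag_mult: "diag f ** diag g = diag (\<lambda>i. f i * g i)"
  by (simp add: diag_def matrix_matrix_mult_def vec_eq_iff if_distrib[of "\<lambda>x. x * _"]
      if_distrib[of "\<lambda>x. _ * x"] sum.delta cong: if_cong)

lemma diag_add: "diag f + diag g = diag (\<lambda>i. f i + g i)"
  by (simp add: diag_def vec_eq_iff)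

lemma scaleR_diag: "c *\<^sub>R diag f = diag (\<lambda>i. c * f i)"
  by (simp add: diag_def vec_eq_iff)

lemma trace_diag: "trace (diag f) = (\<Sum>i\<in>UNIV. f i)"
  by (simp add: trace_def diag_def)

text \<open>\<open>matrix_inv\<close> is a choice among two-sided inverses: the explicit inverse
  shows that one exists, and multiplying by it from the left identifies the chosen one.\<close>

lemma matrix_inv_diag:
  assumes "\<And>i. f i \<noteq> 0"
  shows "matrix_inv (diag f) = diag (\<lambda>i. inverse (f i))"
proof -
  let ?A = "diag f" and ?B = "diag (\<lambda>i. inverse (f i))"
  have one: "?A ** ?B = mat 1" "?B ** ?A = mat 1"
    using assms by (simp_all add: diag_mult) (simp_all add: diag_def mat_def)
  then have "?A ** matrix_inv ?A = mat 1 \<and> matrix_inv ?A ** ?A = mat 1"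
    unfolding matrix_inv_def by (rule_tac someI) blast
  then have "?B ** (?A ** matrix_inv ?A) = ?B"
    by simp
  then show ?thesis
    by (simp add: matrix_mul_assoc one)
qed

section \<open>Moments of the normalised precoder and the effective SINR\<close>

context cf_model
begin

interpretation P: prob_space "prob_sp S"
  by (rule prob_space)

lemma expect_eq: "has_bochner_integral (prob_sp S) f x \<Longrightarrow> expect S f = x"
  unfolding expect_def by (rule has_bochner_integral_integral_eq)

lemma copilot_sym: "k \<in> copilot S l \<longleftrightarrow> l \<in> copilot S k"
  by (auto simp: copilot_def)

lemma expect_h_mmse: "expect S (\<lambda>\<omega>. (cmod (h_mmse S n l \<omega>))\<^sup>2) = mmse_power n l"
  by (rule expect_eq[OF channel_mmse_moments(2)])

lemma mr_mmse_eq: "mr_mmse S n l \<omega> = h_mmse S n l \<omega> / of_real (sqrt (mmse_power n l))"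
  by (simp add: mr_mmse_def expect_h_mmse)

lemma mmse_contamination_self:
  "mmse_contamination n k k = pilot_power S k * pilot_len S * beta S n k / lam S n k"
  using pilot_power_pos[of k] by (simp add: mmse_contamination_def mmse_gain_def copilot_def)

lemma mmse_contamination_square:
  "(mmse_contamination n k l)\<^sup>2 = (if l \<in> copilot S k then
     pilot_power S k * pilot_power S l * (pilot_len S)\<^sup>2 * (beta S n l)\<^sup>2 / (lam S n l)\<^sup>2 else 0)"
  using pilot_power_pos[of k]
  by (simp add: mmse_contamination_def copilot_sym power_mult_distrib mmse_gain_square)

text \<open>The correlation of the channel with its own estimate equals the power of the estimate,
  in line with the orthogonality principle; dividing by the root of that power leaves the
  root.\<close>

lemma expect_mr_mmse:
  "expect S (\<lambda>\<omega>. cnj (channel S n k \<omega>) * mr_mmse S n k \<omega>) = of_real (sqrt (mmse_power n k))"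
proof -
  have "(los S n k)\<^sup>2 + mmse_contamination n k k * beta S n k = mmse_power n k"
    by (simp add: mmse_contamination_self mmse_power_def power2_eq_square)
  then have "has_bochner_integral (prob_sp S)
      (\<lambda>\<omega>. cnj (channel S n k \<omega>) * h_mmse S n k \<omega> / of_real (sqrt (mmse_power n k)))
      (of_real (mmse_power n k) / of_real (sqrt (mmse_power n k)))"
    using channel_mmse_moments(1)[of n k k] by (intro has_bochner_integral_divide_zero) simp
  moreover have "complex_of_real (mmse_power n k) / of_real (sqrt (mmse_power n k))
      = of_real (sqrt (mmse_power n k))"
    using mmse_power_pos[of n k] by (simp only: real_div_sqrt less_imp_le flip: of_real_divide)
  ultimately show ?thesis
    by (intro expect_eq) (simp add: mr_mmse_eq)
qed

text \<open>Normalisation divides by the power of the estimate, so the product of second moments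
  reduces to \<open>beta'\<close> and only the correlation terms keep a denominator.\<close>

lemma expect_square_mr_mmse:
  "expect S (\<lambda>\<omega>. (cmod (cnj (channel S n k \<omega>) * mr_mmse S n l \<omega>))\<^sup>2) =
     beta' S n k + ((mmse_contamination n k l)\<^sup>2 * (beta S n k)\<^sup>2
       + 2 * mmse_contamination n k l * beta S n k * (if k = l then (los S n k)\<^sup>2 else 0)) / mmse_power n l"
proof (rule expect_eq)
  let ?c = "(mmse_contamination n k l)\<^sup>2 * (beta S n k)\<^sup>2"
  let ?d = "2 * mmse_contamination n k l * beta S n k * (if k = l then (los S n k)\<^sup>2 else 0)"
  have "(cmod (cnj (channel S n k \<omega>) * mr_mmse S n l \<omega>))\<^sup>2 =
      (cmod (cnj (channel S n k \<omega>) * h_mmse S n l \<omega>))\<^sup>2 / mmse_power n l" for \<omega>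
    using mmse_power_pos[of n l]
    by (simp add: mr_mmse_eq norm_mult norm_divide power_mult_distrib power_divide)
  moreover have "beta' S n k + (?c + ?d) / mmse_power n l
      = (beta' S n k * mmse_power n l + ?c + ?d) / mmse_power n l"
    using mmse_power_pos[of n l] by (simp add: add_divide_distrib)
  ultimately show "has_bochner_integral (prob_sp S)
      (\<lambda>\<omega>. (cmod (cnj (channel S n k \<omega>) * mr_mmse S n l \<omega>))\<^sup>2)
      (beta' S n k + (?c + ?d) / mmse_power n l)"
    using has_bochner_integral_divide_zero[OF channel_mmse_moments(3)[of n k l], of "mmse_power n l"]
    by (simp only:)
qed

text \<open>For \<open>l \<noteq> k\<close> the line-of-sight term is absent, and the squared
  contamination vanishes off the pilot group; for \<open>l = k\<close> both terms are
  present.\<close>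

lemma expect_square_mr_mmse_cases:
  "expect S (\<lambda>\<omega>. (cmod (cnj (channel S n k \<omega>) * mr_mmse S n l \<omega>))\<^sup>2) =
     beta' S n k +
     (if l \<in> copilot S k - {k} then
        (pilot_power S k * pilot_power S l * (pilot_len S)\<^sup>2
           * (beta S n k)\<^sup>2 * (beta S n l)\<^sup>2 / (lam S n l)\<^sup>2) / mmse_power n l
      else if l = k then
        ((pilot_power S k)\<^sup>2 * (pilot_len S)\<^sup>2 * (beta S n k) ^ 4 / (lam S n k)\<^sup>2
           + 2 * pilot_power S k * pilot_len S * (beta S n k)\<^sup>2 / lam S n k * (los S n k)\<^sup>2)
        / mmse_power n k
      else 0)"
proof (cases "l = k")
  case True
  have "(beta S n k) ^ 4 = (beta S n k)\<^sup>2 * (beta S n k)\<^sup>2"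
    by (simp flip: power_add)
  then have "(mmse_contamination n k k)\<^sup>2 * (beta S n k)\<^sup>2 =
      (pilot_power S k)\<^sup>2 * (pilot_len S)\<^sup>2 * (beta S n k) ^ 4 / (lam S n k)\<^sup>2"
    by (simp add: mmse_contamination_self power_mult_distrib power_divide)
  moreover have "2 * mmse_contamination n k k * beta S n k * (los S n k)\<^sup>2 =
      2 * pilot_power S k * pilot_len S * (beta S n k)\<^sup>2 / lam S n k * (los S n k)\<^sup>2"
    by (simp add: mmse_contamination_self power2_eq_square[of "beta S n k"])
  ultimately show ?thesis
    unfolding expect_square_mr_mmse True by simp
next
  case False
  then show ?thesis
    unfolding expect_square_mr_mmse mmse_contamination_square by simp
qed

lemma Lam_mat_diag: "Lam_mat S k = diag (\<lambda>n. inverse (lam S n k))"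
  unfolding Lam_mat_def using lam_pos by (intro matrix_inv_diag) (metis less_irrefl)

lemma Z_mat_diag: "Z_mat S k = diag (\<lambda>n. mmse_power n k)"
  unfolding Z_mat_def Omega_mat_def R_mat_def L_mat_def Lam_mat_diag diag_mult diag_add scaleR_diag mmse_power_def
  by (simp add: divide_inverse power2_eq_square mult_ac)

lemma matrix_inv_Z_mat: "matrix_inv (Z_mat S k) = diag (\<lambda>n. inverse (mmse_power n k))"
  unfolding Z_mat_diag using mmse_power_pos by (intro matrix_inv_diag) (metis less_irrefl)

text \<open>All matrices are diagonal, so every trace is a sum over access points. The one
  cancellation is between the user's own excess term and the subtracted signal power.\<close>

lemma sinr_mr_mmse:
  "sinr_dl_nc S (mr_mmse S) k =
      trace (D_mat S k ** Z_mat S k)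
      / ((\<Sum>l\<in>UNIV. trace (D_mat S l ** R'_mat S k))
         + (\<Sum>l\<in>copilot S k - {k}. pilot_power S k * pilot_power S l * (pilot_len S)\<^sup>2
              * trace (D_mat S l
                  ** ((R_mat S k ** Lam_mat S l ** R_mat S l) ** (R_mat S k ** Lam_mat S l ** R_mat S l))
                  ** matrix_inv (Z_mat S l)))
         - trace (D_mat S k ** (L_mat S k ** L_mat S k) ** matrix_inv (Z_mat S k))
         + var_dl S)"
proof -
  \<comment> \<open>\<open>F\<close> is the contamination by a pilot-sharing user, \<open>x\<close>
    the scattered part of the user's own \<open>mmse_power\<close>, and \<open>G\<close> the excess
    in the case \<open>l = k\<close>.\<close>
  define F where "F n l = pilot_power S k * pilot_power S l * (pilot_len S)\<^sup>2
     * (beta S n k)\<^sup>2 * (beta S n l)\<^sup>2 / (lam S n l)\<^sup>2 / mmse_power n l" for n l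
  define x where "x n = pilot_power S k * pilot_len S * (beta S n k)\<^sup>2 / lam S n k" for n
  define G where "G n = ((x n)\<^sup>2 + 2 * x n * (los S n k)\<^sup>2) / mmse_power n k" for n
  have x2: "(x n)\<^sup>2 = (pilot_power S k)\<^sup>2 * (pilot_len S)\<^sup>2 * (beta S n k) ^ 4 / (lam S n k)\<^sup>2" for n
    unfolding x_def power_divide power_mult_distrib by (simp flip: power_mult)
  have x1: "2 * x n * (los S n k)\<^sup>2 =
      2 * pilot_power S k * pilot_len S * (beta S n k)\<^sup>2 / lam S n k * (los S n k)\<^sup>2" for n
    by (simp add: x_def)
  \<comment> \<open>Nested cases become a sum of two disjointly supported terms, so the sum over
    \<open>l\<close> splits linearly.\<close>
  have sq: "expect S (\<lambda>\<omega>. (cmod (cnj (channel S n k \<omega>) * mr_mmse S n l \<omega>))\<^sup>2) =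
      beta' S n k + ((if l \<in> copilot S k - {k} then F n l else 0) + (if l = k then G n else 0))" for n l
    unfolding expect_square_mr_mmse_cases F_def G_def x1 x2 by (cases "l = k") simp_all
  \<comment> \<open>With Q = x + L and L the squared line-of-sight amplitude, x^2 + 2 x L = Q^2 -
    L^2, so G - Q = - L^2 / Q. This is the source of the negative trace in the denominator.\<close>
  have G: "G n - mmse_power n k = - ((los S n k)\<^sup>2 * (los S n k)\<^sup>2 * inverse (mmse_power n k))" for n
  proof -
    have Q: "mmse_power n k = x n + (los S n k)\<^sup>2"
      by (simp add: mmse_power_def x_def)
    have nz: "x n + (los S n k)\<^sup>2 \<noteq> 0"
      using mmse_power_pos[of n k] unfolding Q by simp
    have "(x n)\<^sup>2 + 2 * x n * (los S n k)\<^sup>2 = (x n + (los S n k)\<^sup>2) * (x n + (los S n k)\<^sup>2)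
        - (los S n k)\<^sup>2 * (los S n k)\<^sup>2"
      by algebra
    then show ?thesis
      unfolding G_def Q using nz by (simp add: diff_divide_distrib) (simp add: divide_inverse)
  qed
  have "(\<Sum>n\<in>UNIV. \<Sum>l\<in>UNIV. dl_power S n l * expect S (\<lambda>\<omega>. (cmod (cnj (channel S n k \<omega>) * mr_mmse S n l \<omega>))\<^sup>2))
      = (\<Sum>l\<in>UNIV. \<Sum>n\<in>UNIV. dl_power S n l * beta' S n k)
        + (\<Sum>l\<in>copilot S k - {k}. \<Sum>n\<in>UNIV. dl_power S n l * F n l) + (\<Sum>n\<in>UNIV. dl_power S n k * G n)"
  proof -
    have contaminated: "(\<Sum>l\<in>UNIV. dl_power S n l * (if l \<in> copilot S k - {k} then F n l else 0))
        = (\<Sum>l\<in>copilot S k - {k}. dl_power S n l * F n l)" for n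
      by (rule sum.mono_neutral_cong_right) auto
    have own: "(\<Sum>l\<in>UNIV. dl_power S n l * (if l = k then G n else 0)) = (\<Sum>l\<in>{k}. dl_power S n l * G n)" for n
      by (rule sum.mono_neutral_cong_right) auto
    show ?thesis
      unfolding sq distrib_left sum.distrib contaminated own
      using sum.swap[of "\<lambda>n l. dl_power S n l * beta' S n k" UNIV UNIV]
        sum.swap[of "\<lambda>n l. dl_power S n l * F n l" "copilot S k - {k}" UNIV]
      by simp
  qed
  moreover have "(\<Sum>n\<in>UNIV. dl_power S n k * (cmod (expect S (\<lambda>\<omega>. cnj (channel S n k \<omega>) * mr_mmse S n k \<omega>)))\<^sup>2)
      = (\<Sum>n\<in>UNIV. dl_power S n k * mmse_power n k)"
    using mmse_power_pos by (simp add: expect_mr_mmse less_imp_le)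
  moreover have "trace (D_mat S k ** Z_mat S k) = (\<Sum>n\<in>UNIV. dl_power S n k * mmse_power n k)"
    by (simp add: D_mat_def Z_mat_diag diag_mult trace_diag)
  moreover have "trace (D_mat S l ** R'_mat S k) = (\<Sum>n\<in>UNIV. dl_power S n l * beta' S n k)" for l
    by (simp add: D_mat_def R'_mat_def R_mat_def L_mat_def diag_add diag_mult trace_diag beta'_def)
  moreover have "pilot_power S k * pilot_power S l * (pilot_len S)\<^sup>2 * trace (D_mat S l
        ** ((R_mat S k ** Lam_mat S l ** R_mat S l) ** (R_mat S k ** Lam_mat S l ** R_mat S l))
        ** matrix_inv (Z_mat S l)) = (\<Sum>n\<in>UNIV. dl_power S n l * F n l)" for l
    unfolding D_mat_def R_mat_def Lam_mat_diag matrix_inv_Z_mat diag_mult trace_diag sum_distrib_left F_def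
    by (intro sum.cong) (simp_all add: divide_inverse power2_eq_square mult_ac)
  moreover have "trace (D_mat S k ** (L_mat S k ** L_mat S k) ** matrix_inv (Z_mat S k))
      = - (\<Sum>n\<in>UNIV. dl_power S n k * (G n - mmse_power n k))"
    unfolding G
    by (simp add: D_mat_def L_mat_def matrix_inv_Z_mat diag_mult trace_diag mult_ac sum_negf)
  ultimately show ?thesis
    unfolding sinr_dl_nc_def by (simp add: right_diff_distrib sum_subtractf)
qed

end

theorem mainTheorem7:
  fixes S :: "('w, 'ap::finite, 'ue::finite, 'pl::finite) cf_system"
    and w :: "'ap \<Rightarrow> 'ue \<Rightarrow> 'w \<Rightarrow> complex"
  assumes "cf_model S"
    and "\<And>m k \<omega>. w m k \<omega> = mr_mmse S m k \<omega>"
  shows "(\<forall>n k l.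
      expect S (\<lambda>\<omega>. cnj (channel S n k \<omega>) * w n k \<omega>) =
        of_real (sqrt (pilot_power S k * pilot_len S * (beta S n k)\<^sup>2 / lam S n k + (los S n k)\<^sup>2))
    \<and> expect S (\<lambda>\<omega>. (cmod (h_mmse S n l \<omega>))\<^sup>2) =
        pilot_power S l * pilot_len S * (beta S n l)\<^sup>2 / lam S n l + (los S n l)\<^sup>2
    \<and> expect S (\<lambda>\<omega>. (cmod (cnj (channel S n k \<omega>) * w n l \<omega>))\<^sup>2) =
        beta' S n k +
        (if l \<in> copilot S k - {k} then
           (pilot_power S k * pilot_power S l * (pilot_len S)\<^sup>2
              * (beta S n k)\<^sup>2 * (beta S n l)\<^sup>2 / (lam S n l)\<^sup>2)
           / (pilot_power S l * pilot_len S * (beta S n l)\<^sup>2 / lam S n l + (los S n l)\<^sup>2)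
         else if l = k then
           ((pilot_power S k)\<^sup>2 * (pilot_len S)\<^sup>2 * (beta S n k) ^ 4 / (lam S n k)\<^sup>2
              + 2 * pilot_power S k * pilot_len S * (beta S n k)\<^sup>2 / lam S n k * (los S n k)\<^sup>2)
           / (pilot_power S k * pilot_len S * (beta S n k)\<^sup>2 / lam S n k + (los S n k)\<^sup>2)
         else 0))
  \<and> (\<forall>k. sinr_dl_nc S w k =
      trace (D_mat S k ** Z_mat S k)
      / ((\<Sum>l\<in>UNIV. trace (D_mat S l ** R'_mat S k))
         + (\<Sum>l\<in>copilot S k - {k}. pilot_power S k * pilot_power S l * (pilot_len S)\<^sup>2
              * trace (D_mat S l
                  ** ((R_mat S k ** Lam_mat S l ** R_mat S l) ** (R_mat S k ** Lam_mat S l ** R_mat S l))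
                  ** matrix_inv (Z_mat S l)))
         - trace (D_mat S k ** (L_mat S k ** L_mat S k) ** matrix_inv (Z_mat S k))
         + var_dl S))"
proof -
  interpret cf_model S by fact
  have "w = mr_mmse S"
    using assms(2) by (intro ext)
  then show ?thesis
    using expect_mr_mmse expect_h_mmse expect_square_mr_mmse_cases sinr_mr_mmse
    unfolding mmse_power_def by simp
qed

end
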